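(* Let $\varphi:\mathbb{R}^n\to\mathbb{R}^n$ be of class $C^1$, let $K\subset\mathbb{R}^n$ be compact with $\varphi(K)\subset K$, and consider the discrete-time system $x(t+1)=\varphi[x(t)]$, $t=0,1,2,\ldots$, $x(0)\in K$. Let $H_{\mathrm{res}}(\varphi,K)$ denote its restoration entropy. For a continuous map $P:K\to\mathcal{S}^+$ and $x\in K$ put (with $\log 0:=-\infty$) $$\varSigma^P(x|\varphi):=\sum_{i=1}^n\max\{0,\log\alpha_i^P(x|\varphi)\},$$ where $\alpha_1^P(x|\varphi)\ge\cdots\ge\alpha_n^P(x|\varphi)\ge 0$ are the singular values of $\mathbf{D}\varphi(x)$ in the metric $P$. Then: (i) For every continuous map $P:K\to\mathcal{S}^+$, $$H_{\mathrm{res}}(\varphi,K)\le\max_{x\in K}\varSigma^P(x|\varphi).$$ (ii) Suppose in addition that $K$ is the closure of its interior and that the Jacobian matrix $\mathbf{D}\varphi(x)$ is invertible for every $x\in K$. Then for every $\varepsilon>0$ there exists a continuous map $P:K\to\mathcal{S}^+$ such that $$H_{\mathrm{res}}(\varphi,K)\ge\max_{x\in K}\varSigma^P(x|\varphi)-\varepsilon.$$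
   Context: $\log$ is the logarithm to base $2$. $\mathbf{D}\varphi(x)$ is the Jacobian matrix. $\mathcal{S}^+$ is the set of real symmetric positive definite $n\times n$ matrices. $B_\delta(a)$ is the open Euclidean ball of radius $\delta$ centered at $a$ in $\mathbb{R}^n$. Restoration entropy: $\varphi^\tau$ denotes the time-$\tau$ map of the system (here the $\tau$-th iterate of $\varphi$). For an integer $\tau\ge 0$, a point $a$ and $\delta>0$, let $N_{\varphi,K}(\tau,a,\delta)$ be the minimal number of open $\delta$-balls needed to cover $\varphi^\tau[B_\delta(a)\cap K]$. Then $$H_{\mathrm{res}}(\varphi,K):=\lim_{\tau\to\infty}\frac1\tau\limsup_{\delta\to0}\sup_{a\in K}\log N_{\varphi,K}(\tau,a,\delta),$$ where the limit in $\tau$ exists by subadditivity. Singular values in the metric $P$: for continuous $P:K\to\mathcal{S}^+$ put $\langle v,w\rangle_{P,x}:=\langle P(x)v,w\rangle$ with $\langle\cdot,\cdot\rangle$ the standard inner product. The numbers $\alpha_1^P(x|\varphi)\ge\cdots\ge\alpha_n^P(x|\varphi)\ge0$ are the singular values (with multiplicity) of $\mathbf{D}\varphi(x)$ viewed as an operator from $(\mathbb{R}^n,\langle\cdot,\cdot\rangle_{P,x})$ to $(\mathbb{R}^n,\langle\cdot,\cdot\rangle_{P,\varphi(x)})$, i.e. the square roots of the eigenvalues of $\mathbf{D}\varphi(x)^*\mathbf{D}\varphi(x)$ with the adjoint taken with respect to these two inner products; equivalently, the ordinary singular values of $P(\varphi(x))^{1/2}\mathbf{D}\varphi(x)P(x)^{-1/2}$.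 *)

theory Defs
  imports "HOL-Analysis.Analysis" "HOL-Computational_Algebra.Polynomial"
begin

definition C1_map :: "(real^'n \<Rightarrow> real^'n) \<Rightarrow> bool" where
  "C1_map f \<longleftrightarrow>
     (\<forall>x. f differentiable (at x)) \<and> continuous_on UNIV (\<lambda>x. jacobian f (at x))"

definition pos_def_matrices :: "(real^'n^'n) set" where
  "pos_def_matrices = {A. transpose A = A \<and> (\<forall>v. v \<noteq> 0 \<longrightarrow> (A *v v) \<bullet> v > 0)}"

text \<open>The base-2 logarithm on \<open>[0, \<infinity>)\<close> with \<open>log 0 = -\<infinity>\<close>. The library's
  \<open>log 2 0\<close> is \<open>0\<close>.\<close>

definition elog2 :: "real \<Rightarrow> ereal" where
  "elog2 a = (if a = 0 then -\<infinity> else ereal (log 2 a))"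


subsection \<open>Restoration entropy\<close>

text \<open>The centres of the covering balls may be arbitrary points of the ambient space. If
  \<open>K\<close> is compact and mapped into itself, finite covers exist, so the least
  number is attained.\<close>

definition covering_number ::
    "(real^'n \<Rightarrow> real^'n) \<Rightarrow> (real^'n) set \<Rightarrow> nat \<Rightarrow> real^'n \<Rightarrow> real \<Rightarrow> nat" where
  "covering_number f K t a d =
     (LEAST m. \<exists>C. finite C \<and> card C = m \<and> (f ^^ t) ` (ball a d \<inter> K) \<subseteq> (\<Union>c\<in>C. ball c d))"

definition restoration_entropy :: "(real^'n \<Rightarrow> real^'n) \<Rightarrow> (real^'n) set \<Rightarrow> ereal" where
  "restoration_entropy f K =
     lim (\<lambda>t. ereal (1 / real t) *
       Limsup (at_right 0) (\<lambda>d. SUP a\<in>K. elog2 (real (covering_number f K t a d))))"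


subsection \<open>Singular values in a metric\<close>

definition metric_inner :: "real^'n^'n \<Rightarrow> real^'n \<Rightarrow> real^'n \<Rightarrow> real" where
  "metric_inner P v w = (P *v v) \<bullet> w"

text \<open>The adjoint of \<open>A\<close> as an operator from the space with inner product
  \<open>metric_inner P\<close> to the space with inner product \<open>metric_inner Q\<close>; it exists and
  is unique for positive definite \<open>P\<close>, \<open>Q\<close>.\<close>

definition metric_adjoint ::
    "real^'n^'n \<Rightarrow> real^'n^'n \<Rightarrow> real^'n^'n \<Rightarrow> real^'n^'n" where
  "metric_adjoint P Q A =
     (THE B. \<forall>v w. metric_inner Q (A *v v) w = metric_inner P v (B *v w))"

definition charpoly :: "real^'n^'n \<Rightarrow> real poly" where
  "charpoly A = det (mat [:0, 1:] - map_matrix (\<lambda>c. [:c:]) A)"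

text \<open>The singular values with multiplicity, in decreasing order. For positive definite
  \<open>P\<close>, \<open>Q\<close> the operator \<open>metric_adjoint P Q A ** A\<close> is self-adjoint and
  positive semidefinite with respect to \<open>metric_inner P\<close>, so its characteristic polynomial
  splits over the reals and the list has length \<open>CARD('n)\<close>.\<close>

definition metric_singular_values ::
    "real^'n^'n \<Rightarrow> real^'n^'n \<Rightarrow> real^'n^'n \<Rightarrow> real list" where
  "metric_singular_values P Q A =
     rev (sorted_list_of_multiset (image_mset sqrt (proots (charpoly (metric_adjoint P Q A ** A)))))"

definition alpha ::
    "(real^'n \<Rightarrow> real^'n^'n) \<Rightarrow> (real^'n \<Rightarrow> real^'n) \<Rightarrow> real^'n \<Rightarrow> nat \<Rightarrow> real" where
  "alpha P f x i = metric_singular_values (P x) (P (f x)) (jacobian f (at x)) ! (i - 1)"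

definition Sigma_metric ::
    "(real^'n \<Rightarrow> real^'n^'n) \<Rightarrow> (real^'n \<Rightarrow> real^'n) \<Rightarrow> real^'n \<Rightarrow> ereal" where
  "Sigma_metric P f x = (\<Sum>i = 1..CARD('n). max 0 (elog2 (alpha P f x i)))"

end

theory Submission
  imports Defs
begin

text \<open>The Loewner description is used in place of the singular values themselves because every
  estimate then comes down to exhibiting one symmetric \<open>R\<close>, and the pulled back form
  may be degenerate, as (i) demands.

  Comparing covering numbers with determinants, recentring balls and passing between
  \<open>P\<close> and the Euclidean metric cost factors depending on the dimension,
  \<open>K\<close> and \<open>P\<close>, never on \<open>t\<close>. After the logarithm and the
  division by \<open>t\<close> they vanish, so crude volume estimates suffice.

  In (ii) the slack \<open>\<epsilon>\<close> is spent once, on the choice of \<open>t\<close>; the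
  halving itself is exact. Geometric means commute with congruence, so if \<open>P'\<close> is the
  mean of \<open>P\<close> and its pullback by \<open>t\<close> steps, the pullback of
  \<open>P'\<close> by \<open>t\<close> steps is the mean of the pullbacks of \<open>P\<close> by
  \<open>t\<close> and by \<open>2 * t\<close> steps. The shared form leaves only the comparison of
  \<open>P\<close> with its pullback by \<open>2 * t\<close> steps. Positive definiteness of these
  pullbacks is where invertibility enters. The lower covering bound requires a full ball around the
  point inside \<open>K\<close>, hence interior points first and then their closure.\<close>

text \<open>The product of \<open>max 1 (\<alpha>\<^sub>i\<^sup>2)\<close> over the singular values of \<open>A\<close> from the metric \<open>P\<close> to the metric
  \<open>Q\<close> is the least value of \<open>det R / det P\<close> over all symmetric \<open>R\<close> that dominate both \<open>P\<close> and the
  pullback \<open>A\<^sup>T Q A\<close> in the Loewner order. This description makes the product submultiplicative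
  along orbits, and it shows that passing from two metrics to their geometric means with a common third
  one replaces the product by at most its square root.

  Up to bounded factors, \<open>\<phi>\<^sup>t\<close> maps a small \<open>\<delta>\<close>-ball around \<open>a\<close> onto a set that needs
  \<open>sqrt (det (1 + L L\<^sup>T))\<close> balls of radius \<open>\<delta>\<close>, where \<open>L\<close> is the derivative of \<open>\<phi>\<^sup>t\<close> at \<open>a\<close>;
  this gives (i). For (ii), take \<open>t = 2\<^sup>k\<close> so large that the Euclidean metric has \<open>t\<close>-step expansion at most \<open>t (H + \<epsilon>)\<close>, and
  repeatedly replace \<open>P\<close> by the geometric mean of \<open>P\<close> and its \<open>t/2\<close>-step pullback: this halves both the
  number of steps and the bound, until one step with bound \<open>H + \<epsilon>\<close> remains.\<close>

subsection \<open>Quadratic forms and the spectral theorem\<close>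

definition quad :: "real^'n^'n \<Rightarrow> real^'n \<Rightarrow> real" where
  "quad A v = (A *v v) \<bullet> v"

text \<open>Only the symmetric part of a matrix enters this relation, so antisymmetry and
  determinant comparisons carry symmetry hypotheses of their own.\<close>

definition loewner_le :: "real^'n^'n \<Rightarrow> real^'n^'n \<Rightarrow> bool" (infix "\<preceq>" 50) where
  "A \<preceq> B \<longleftrightarrow> (\<forall>v. quad A v \<le> quad B v)"

definition diag :: "('n \<Rightarrow> real) \<Rightarrow> real^'n^'n" where
  "diag l = (\<chi> i j. if i = j then l i else 0)"

lemma inner_matrix_vector: "(A *v x) \<bullet> y = x \<bullet> (transpose A *v y)" for A :: "real^'n^'m"
  by (metis dot_lmul_matrix inner_commute transpose_matrix_vector)

lemma quad_add: "quad (A + B) v = quad A v + quad B v"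
  and quad_diff: "quad (A - B) v = quad A v - quad B v"
  by (simp_all add: quad_def algebra_simps inner_add_left inner_diff_left)

lemma quad_scaleR: "quad (c *\<^sub>R A) v = c * quad A v"
  by (simp add: quad_def flip: scaleR_matrix_vector_assoc)

lemma quad_scaleR_vector: "quad A (c *\<^sub>R v) = c\<^sup>2 * quad A v"
  by (simp add: quad_def matrix_vector_mult_scaleR power2_eq_square)

lemma quad_mat_1: "quad (mat 1) v = (norm v)\<^sup>2"
  by (simp add: quad_def power2_norm_eq_inner)

lemma quad_congruence: "quad (transpose M ** A ** M) v = quad A (M *v v)"
  unfolding quad_def by (metis inner_commute inner_matrix_vector matrix_vector_mul_assoc)

lemma quad_transpose_mult: "quad (transpose M ** M) v = (norm (M *v v))\<^sup>2"
  using quad_congruence[of M "mat 1" v] by (simp add: quad_mat_1)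

lemma diag_vector_component: "(diag l *v v) $ i = l i * v $ i"
  by (simp add: diag_def matrix_vector_mult_def if_distrib[of "\<lambda>x. x * _"] cong: if_cong)

lemma quad_diag: "quad (diag l) v = (\<Sum>i\<in>UNIV. l i * (v $ i)\<^sup>2)"
  by (simp add: quad_def inner_vec_def diag_vector_component power2_eq_square mult.assoc)

lemma det_diag: "det (diag l) = (\<Prod>i\<in>UNIV. l i)"
  by (subst det_diagonal) (auto simp: diag_def)

lemma transpose_diag: "transpose (diag l) = diag l"
  by (auto simp: diag_def transpose_def vec_eq_iff)

lemma diag_mult: "diag l ** diag m = diag (\<lambda>i. l i * m i)"
proof -
  have "(diag l ** diag m) *v v = diag (\<lambda>i. l i * m i) *v v" for v
    by (simp add: vec_eq_iff diag_vector_component mult.assoc flip: matrix_vector_mul_assoc)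
  then show ?thesis
    by (simp add: matrix_eq)
qed

lemma diag_one: "diag (\<lambda>i. 1) = mat 1"
  by (simp add: diag_def mat_def)

lemma trace_diag: "trace (diag l) = (\<Sum>i\<in>UNIV. l i)"
  by (simp add: trace_def diag_def)

lemma quad_axis: "quad A (axis i 1) = A $ i $ i"
  by (simp add: quad_def matrix_vector_mult_basis inner_axis column_def)

lemma transpose_add: "transpose (A + B) = transpose A + transpose B"
  and transpose_diff: "transpose (A - B) = transpose A - transpose B"
  for A B :: "real^'n^'m"
  by (simp_all add: transpose_def vec_eq_iff)

lemma transpose_congruence:
  fixes A M :: "real^'n^'n"
  assumes "transpose A = A"
  shows "transpose (transpose M ** A ** M) = transpose M ** A ** M"
  by (simp add: assms matrix_transpose_mul matrix_mul_assoc)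

lemma polarization:
  fixes A :: "real^'n^'n"
  assumes "transpose A = A"
  shows "quad A (v + w) = quad A v + quad A w + 2 * ((A *v v) \<bullet> w)"
proof -
  have "(A *v w) \<bullet> v = (A *v v) \<bullet> w"
    by (metis assms inner_commute inner_matrix_vector)
  then show ?thesis
    by (simp add: quad_def matrix_vector_right_distrib inner_add_left inner_add_right)
qed

lemma symmetric_matrix_eqI:
  fixes A B :: "real^'n^'n"
  assumes A: "transpose A = A" and B: "transpose B = B" and q: "\<And>v. quad A v = quad B v"
  shows "A = B"
proof -
  have "(A *v v) \<bullet> w = (B *v v) \<bullet> w" for v w
    using polarization[OF A, of v w] polarization[OF B, of v w] q by simp
  then show ?thesis
    by (metis matrix_eq vector_eq_rdot)
qed

text \<open>A maximizer \<open>u\<close> of the quadratic form on the unit sphere of an invariant subspace is an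
  eigenvector: the first variation in every direction orthogonal to \<open>u\<close> vanishes.\<close>

lemma symmetric_invariant_subspace_eigenvector:
  fixes A :: "real^'n^'n"
  assumes A: "transpose A = A" and V: "subspace V" "V \<noteq> {0}"
    and inv: "\<And>v. v \<in> V \<Longrightarrow> A *v v \<in> V"
  shows "\<exists>u\<in>V. \<exists>c. norm u = 1 \<and> A *v u = c *\<^sub>R u"
proof -
  obtain z where z: "z \<in> V" "z \<noteq> 0"
    using V subspace_0 by blast
  let ?S = "sphere 0 1 \<inter> V"
  have "compact ?S"
    using V by (simp add: closed_subspace compact_Int_closed)
  moreover have "(inverse (norm z)) *\<^sub>R z \<in> ?S"
    using z V by (simp add: subspace_scale)
  moreover have "continuous_on ?S (quad A)"
    unfolding quad_def by (intro continuous_intros linear_continuous_on) auto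
  ultimately obtain u where u: "u \<in> ?S" and umax: "\<And>v. v \<in> ?S \<Longrightarrow> quad A v \<le> quad A u"
    by (metis continuous_attains_sup empty_iff)
  have nu: "norm u = 1" and uV: "u \<in> V"
    using u by auto
  define c where "c = quad A u"
  have bound: "quad A v \<le> c * (norm v)\<^sup>2" if "v \<in> V" for v
  proof (cases "v = 0")
    case False
    have "quad A (inverse (norm v) *\<^sub>R v) \<le> c"
      using False that V unfolding c_def by (intro umax) (simp add: subspace_scale)
    then show ?thesis
      using False by (simp add: quad_scaleR_vector power_inverse field_simps)
  qed (simp add: quad_def)
  have orth: "(A *v u) \<bullet> w = 0" if w: "w \<in> V" "u \<bullet> w = 0" for w
  proof (rule ccontr)
    assume ne: "(A *v u) \<bullet> w \<noteq> 0"
    define b where "b = (A *v u) \<bullet> w"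
    \<comment> \<open>A positive upper bound for the coefficient of \<open>t\<^sup>2\<close>; the
      choice \<open>t = b / k\<close> then turns \<open>main\<close> into a contradiction with
      \<open>b \<noteq> 0\<close>.\<close>
    define k where "k = \<bar>c * (norm w)\<^sup>2 - quad A w\<bar> + 1"
    have main: "2 * t * b \<le> t\<^sup>2 * k" for t
    proof -
      have "quad A (u + t *\<^sub>R w) \<le> c * (norm (u + t *\<^sub>R w))\<^sup>2"
        using w uV V by (intro bound) (simp add: subspace_add subspace_scale)
      moreover have "(norm (u + t *\<^sub>R w))\<^sup>2 = 1 + t\<^sup>2 * (norm w)\<^sup>2"
        using w nu unfolding power2_norm_eq_inner
        by (simp add: algebra_simps inner_commute power2_eq_square norm_eq_1)
      moreover have "quad A (u + t *\<^sub>R w) = c + t\<^sup>2 * quad A w + 2 * t * b"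
        using polarization[OF A, of u "t *\<^sub>R w"] by (simp add: quad_scaleR_vector c_def b_def)
      ultimately have "2 * t * b \<le> t\<^sup>2 * (c * (norm w)\<^sup>2 - quad A w)"
        by (simp add: algebra_simps)
      also have "\<dots> \<le> t\<^sup>2 * k"
        unfolding k_def by (intro mult_left_mono) auto
      finally show ?thesis .
    qed
    have k: "k > 0"
      unfolding k_def by linarith
    have "2 * (b / k) * b \<le> (b / k)\<^sup>2 * k"
      by (rule main)
    then have "b\<^sup>2 * 2 \<le> b\<^sup>2"
      using k by (simp add: power2_eq_square field_simps)
    then show False
      using ne by (simp add: b_def)
  qed
  define r where "r = A *v u - c *\<^sub>R u"
  have rV: "r \<in> V"
    unfolding r_def using uV V inv by (simp add: subspace_diff subspace_scale)
  have ur: "u \<bullet> r = 0"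
    unfolding r_def c_def quad_def using nu by (simp add: inner_diff_right inner_commute norm_eq_1)
  have "r \<bullet> r = (A *v u) \<bullet> r - c * (u \<bullet> r)"
    by (simp add: r_def algebra_simps)
  then have "r = 0"
    using orth[OF rV ur] ur by simp
  then show ?thesis
    using uV nu by (auto simp: r_def)
qed

text \<open>A largest orthonormal set of eigenvectors must span: otherwise its orthogonal complement
  is nonzero, is invariant because \<open>A\<close> is symmetric, and contains one more unit
  eigenvector. The columns of \<open>Q\<close> are the members of this set.\<close>

theorem spectral_theorem:
  fixes A :: "real^'n^'n"
  assumes A: "transpose A = A"
  obtains Q d where "orthogonal_matrix Q" "transpose Q ** A ** Q = diag d"
proof -
  define good where "good B \<longleftrightarrow> pairwise orthogonal B \<and> (\<forall>b\<in>B. norm b = 1 \<and> (\<exists>c. A *v b = c *\<^sub>R b))"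
    for B :: "(real^'n) set"
  have indep: "independent B" if "good B" for B
    using that unfolding good_def by (intro pairwise_orthogonal_independent) auto
  have fin: "finite B \<and> card B \<le> CARD('n)" if "good B" for B
    using independent_bound[OF indep[OF that]] by simp
  have "good {}"
    by (simp add: good_def)
  then obtain B where B: "good B" and Bmax: "\<And>C. good C \<Longrightarrow> card C \<le> card B"
    using ex_has_greatest_nat[of good "{}" card "Suc CARD('n)"] fin by (auto simp: less_Suc_eq_le)
  have finB: "finite B"
    using fin[OF B] by simp
  have "dim (span B) = CARD('n)"
  proof (rule ccontr)
    assume "dim (span B) \<noteq> CARD('n)"
    then have "dim B < DIM(real^'n)"
      using dim_subset_UNIV[of B] by simp
    then obtain x where x: "x \<noteq> 0" "\<And>y. y \<in> span B \<Longrightarrow> orthogonal x y"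
      using orthogonal_to_subspace_exists by blast
    let ?V = "{v. \<forall>b\<in>B. v \<bullet> b = 0}"
    have "subspace ?V"
      by (auto simp: subspace_def inner_add_left)
    moreover have "x \<in> ?V"
      using x(2) by (auto simp: orthogonal_def span_base)
    moreover have "A *v v \<in> ?V" if "v \<in> ?V" for v
    proof -
      have "(A *v v) \<bullet> b = 0" if b: "b \<in> B" for b
      proof -
        obtain c where "A *v b = c *\<^sub>R b"
          using B b by (auto simp: good_def)
        then show ?thesis
          using \<open>v \<in> ?V\<close> b by (simp add: inner_matrix_vector A del: transpose_matrix_vector)
      qed
      then show ?thesis by simp
    qed
    ultimately obtain u c where u: "u \<in> ?V" "norm u = 1" "A *v u = c *\<^sub>R u"
      using symmetric_invariant_subspace_eigenvector[OF A, of ?V] x(1) by blast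
    have "u \<notin> B"
      using u by auto
    moreover have "good (insert u B)"
      using B u unfolding good_def by (auto simp: pairwise_insert orthogonal_def inner_commute)
    ultimately show False
      using Bmax[of "insert u B"] finB by simp
  qed
  then have "card B = CARD('n)"
    using indep[OF B] by (simp add: dim_eq_card_independent)
  then obtain f where f: "bij_betw f (UNIV :: 'n set) B"
    using finB by (metis finite finite_same_card_bij)
  define Q where "Q = (\<chi> i j. f j $ i)"
  have col: "column j Q = f j" for j
    by (simp add: Q_def column_def)
  have fB: "f j \<in> B" for j
    using f bij_betwE by blast
  have "f i \<noteq> f j" if "i \<noteq> j" for i j
    using f that by (meson UNIV_I bij_betw_imp_inj_on inj_on_contraD)
  then have orth: "f i \<bullet> f j = (if i = j then 1 else 0)" for i j
    using B fB unfolding good_def pairwise_def orthogonal_def by (auto simp: norm_eq_1)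
  have "\<forall>j. \<exists>c. A *v f j = c *\<^sub>R f j"
    using B fB unfolding good_def by blast
  then obtain d where d: "\<And>j. A *v f j = d j *\<^sub>R f j"
    using choice by metis
  have "orthogonal_matrix Q"
    using orth by (auto simp: orthogonal_matrix_orthonormal_columns col norm_eq_1 orthogonal_def)
  moreover have "transpose Q ** A ** Q = diag d"
  proof -
    have "(transpose Q ** A ** Q) *v axis j 1 = diag d *v axis j 1" for j
    proof -
      have "(transpose Q ** A ** Q) *v axis j 1 = transpose Q *v (A *v (Q *v axis j 1))"
        by (simp add: matrix_vector_mul_assoc matrix_mul_assoc del: transpose_matrix_vector)
      also have "\<dots> = d j *\<^sub>R (transpose Q *v f j)"
        by (simp only: matrix_vector_mult_basis col d matrix_vector_mult_scaleR)
      also have "\<dots> = diag d *v axis j 1"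
        using orth
        by (auto simp: vec_eq_iff diag_vector_component axis_def vector_matrix_mult_def Q_def inner_vec_def)
      finally show ?thesis .
    qed
    then show ?thesis
      by (auto simp: matrix_vector_mult_basis column_def vec_eq_iff)
  qed
  ultimately show ?thesis
    using that by blast
qed

section \<open>Positive definite matrices, congruence and inverses\<close>

lemma pos_def_quad: "P \<in> pos_def_matrices \<longleftrightarrow> transpose P = P \<and> (\<forall>v. v \<noteq> 0 \<longrightarrow> quad P v > 0)"
  by (simp add: pos_def_matrices_def quad_def)

lemma loewner_refl: "A \<preceq> A"
  and loewner_trans: "A \<preceq> B \<Longrightarrow> B \<preceq> C \<Longrightarrow> A \<preceq> C"
  unfolding loewner_le_def using order_trans by blast+

lemma loewner_congruence: "A \<preceq> B \<Longrightarrow> transpose M ** A ** M \<preceq> transpose M ** B ** M"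
  by (simp add: loewner_le_def quad_congruence)

lemma pos_def_nonneg: "P \<in> pos_def_matrices \<Longrightarrow> 0 \<preceq> P"
  by (metis loewner_le_def order_less_imp_le pos_def_quad order_refl quad_def inner_zero_right matrix_vector_mult_0 inner_zero_left)

lemma pos_def_mono: "P \<in> pos_def_matrices \<Longrightarrow> P \<preceq> R \<Longrightarrow> transpose R = R \<Longrightarrow> R \<in> pos_def_matrices"
  unfolding pos_def_quad loewner_le_def by (meson less_le_trans)

lemma pos_def_mat_1: "mat 1 \<in> pos_def_matrices"
  by (simp add: pos_def_quad quad_mat_1)

lemma pos_def_scaleR: "P \<in> pos_def_matrices \<Longrightarrow> 0 < c \<Longrightarrow> c *\<^sub>R P \<in> pos_def_matrices"
  by (simp add: pos_def_quad quad_scaleR transpose_scalar)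

lemma pos_def_invertible:
  fixes P :: "real^'n^'n"
  assumes "P \<in> pos_def_matrices" shows "invertible P"
proof -
  have "P *v x = 0 \<longrightarrow> x = 0" for x
    using assms by (auto simp: pos_def_quad quad_def)
  then show ?thesis
    by (simp add: invertible_left_inverse matrix_left_invertible_ker)
qed

lemma pos_def_congruence:
  fixes P M :: "real^'n^'n"
  assumes P: "P \<in> pos_def_matrices" and M: "invertible M"
  shows "transpose M ** P ** M \<in> pos_def_matrices"
proof -
  have "M *v v \<noteq> 0" if "v \<noteq> 0" for v
    using that M by (metis invertible_def matrix_left_invertible_ker)
  then show ?thesis
    using P by (auto simp: pos_def_quad quad_congruence transpose_congruence)
qed

lemma pos_def_diag: "(\<And>i. 0 < d i) \<Longrightarrow> diag d \<in> pos_def_matrices"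
  unfolding pos_def_quad transpose_diag quad_diag
proof (intro conjI allI impI refl)
  fix v :: "real^'a"
  assume d: "\<And>i. 0 < d i" and "v \<noteq> 0"
  then obtain i where "v $ i \<noteq> 0"
    by (auto simp: vec_eq_iff)
  then show "0 < (\<Sum>i\<in>UNIV. d i * (v $ i)\<^sup>2)"
    using d by (intro sum_pos2[of UNIV i]) (auto simp: less_imp_le[OF d])
qed

lemma matrix_inv_left: "invertible A \<Longrightarrow> matrix_inv A ** A = mat 1"
  and matrix_inv_right: "invertible A \<Longrightarrow> A ** matrix_inv A = mat 1"
  for A :: "real^'n^'n"
  unfolding invertible_def matrix_inv_def by (metis (mono_tags, lifting) someI_ex)+

lemma matrix_inv_unique:
  fixes A B :: "real^'n^'n"
  assumes "A ** B = mat 1" shows "matrix_inv A = B"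
  by (metis assms invertible_right_inverse matrix_inv_left matrix_mul_assoc matrix_mul_lid matrix_mul_rid)

lemma invertible_matrix_inv: "invertible A \<Longrightarrow> invertible (matrix_inv A)" for A :: "real^'n^'n"
  by (metis invertible_def matrix_inv_left matrix_inv_right)

lemma invertible_transpose: "invertible A \<Longrightarrow> invertible (transpose A)" for A :: "real^'n^'n"
  by (simp add: invertible_det_nz)

lemma matrix_inv_transpose:
  fixes A :: "real^'n^'n"
  assumes "invertible A" shows "matrix_inv (transpose A) = transpose (matrix_inv A)"
  by (metis assms matrix_inv_left matrix_inv_unique matrix_transpose_mul transpose_mat)

lemma matrix_inv_mult:
  fixes A B :: "real^'n^'n"
  assumes "invertible A" "invertible B"
  shows "matrix_inv (A ** B) = matrix_inv B ** matrix_inv A"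
proof (rule matrix_inv_unique)
  have "(A ** B) ** (matrix_inv B ** matrix_inv A) = A ** (B ** matrix_inv B) ** matrix_inv A"
    by (simp add: matrix_mul_assoc)
  then show "(A ** B) ** (matrix_inv B ** matrix_inv A) = mat 1"
    using assms by (simp add: matrix_inv_right)
qed

lemma matrix_inv_cancel:
  fixes A B :: "real^'n^'n"
  assumes "invertible A"
  shows "A ** (matrix_inv A ** B) = B" "matrix_inv A ** (A ** B) = B"
    "(B ** A) ** matrix_inv A = B" "(B ** matrix_inv A) ** A = B"
  using assms by (simp_all add: matrix_mul_assoc matrix_inv_left matrix_inv_right flip: matrix_mul_assoc[of B])

lemma pos_def_matrix_inv:
  fixes P :: "real^'n^'n"
  assumes P: "P \<in> pos_def_matrices" shows "matrix_inv P \<in> pos_def_matrices"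
proof -
  have inv: "invertible P" and sym: "transpose P = P"
    using P pos_def_invertible by (auto simp: pos_def_quad)
  have "transpose (matrix_inv P) ** P ** matrix_inv P = matrix_inv P"
    using inv sym by (metis matrix_inv_cancel(4) matrix_inv_left matrix_inv_transpose matrix_mul_lid)
  then show ?thesis
    using pos_def_congruence[OF P invertible_matrix_inv[OF inv]] by simp
qed

lemma orthogonal_matrix_invertible: "orthogonal_matrix Q \<Longrightarrow> invertible Q" for Q :: "real^'n^'n"
  by (auto simp: orthogonal_matrix_def invertible_def)

lemma congruence_eq_diag_entry:
  fixes P S :: "real^'n^'n"
  assumes P: "P \<in> pos_def_matrices" and S: "invertible S" and d: "transpose S ** P ** S = diag d"
  shows "d i > 0"
proof -
  have "diag d \<in> pos_def_matrices"
    using pos_def_congruence[OF P S] d by simp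
  then have "quad (diag d) (axis i 1) > 0"
    unfolding pos_def_quad by (metis axis_eq_0_iff zero_neq_one)
  then show ?thesis
    unfolding quad_axis by (simp add: diag_def)
qed

text \<open>\<open>T\<close> rescales an eigenbasis of \<open>P\<close> so that \<open>P\<close>
  becomes the identity; a further orthogonal change of basis diagonalizes \<open>Q\<close> and
  leaves the identity alone. The entries \<open>l\<close> are the eigenvalues of \<open>Q\<close>
  relative to \<open>P\<close>.\<close>

theorem simultaneous_diagonalization:
  fixes P Q :: "real^'n^'n"
  assumes P: "P \<in> pos_def_matrices" and Q: "transpose Q = Q"
  obtains S :: "real^'n^'n" and l where "invertible S" "transpose S ** P ** S = mat 1" "transpose S ** Q ** S = diag l"
proof -
  obtain U d where U: "orthogonal_matrix U" and d: "transpose U ** P ** U = diag d"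
    using spectral_theorem P by (metis pos_def_quad)
  have dpos: "d i > 0" for i
    using congruence_eq_diag_entry[OF P orthogonal_matrix_invertible[OF U] d] .
  define T where "T = U ** diag (\<lambda>i. 1 / sqrt (d i))"
  have "transpose T ** P ** T
      = diag (\<lambda>i. 1 / sqrt (d i)) ** (transpose U ** P ** U) ** diag (\<lambda>i. 1 / sqrt (d i))"
    by (simp add: T_def matrix_transpose_mul transpose_diag matrix_mul_assoc)
  also have "\<dots> = mat 1"
    using dpos[THEN less_imp_neq] by (simp add: d diag_mult less_imp_le[OF dpos] flip: diag_one)
  finally have TP: "transpose T ** P ** T = mat 1" .
  obtain V l where V: "orthogonal_matrix V"
    and l: "transpose V ** (transpose T ** Q ** T) ** V = diag l"
    using spectral_theorem transpose_congruence[OF Q] by metis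
  define S where "S = T ** V"
  have cong: "transpose S ** M ** S = transpose V ** (transpose T ** M ** T) ** V" for M
    by (simp add: S_def matrix_transpose_mul matrix_mul_assoc)
  have "transpose S ** P ** S = mat 1"
    using V by (simp add: cong TP orthogonal_matrix)
  moreover from this have "invertible S"
    by (metis invertible_left_inverse)
  ultimately show ?thesis
    using that[of S l] l unfolding cong by blast
qed

lemma pos_def_sqrt:
  fixes P :: "real^'n^'n"
  assumes P: "P \<in> pos_def_matrices"
  obtains T where "T \<in> pos_def_matrices" "T ** T = P"
proof -
  obtain U d where U: "orthogonal_matrix U" and d: "transpose U ** P ** U = diag d"
    using spectral_theorem P by (metis pos_def_quad)
  have UU: "U ** transpose U = mat 1" "transpose U ** U = mat 1"
    using U by (auto simp: orthogonal_matrix_def)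
  have dpos: "d i > 0" for i
    using congruence_eq_diag_entry[OF P orthogonal_matrix_invertible[OF U] d] .
  define T where "T = U ** diag (\<lambda>i. sqrt (d i)) ** transpose U"
  have "T \<in> pos_def_matrices"
    using pos_def_congruence[OF pos_def_diag, of "\<lambda>i. sqrt (d i)" "transpose U"] dpos
      invertible_transpose[OF orthogonal_matrix_invertible[OF U]] by (simp add: T_def)
  moreover have "T ** T = P"
  proof -
    have "T ** T = U ** diag (\<lambda>i. sqrt (d i)) ** (transpose U ** U) ** diag (\<lambda>i. sqrt (d i)) ** transpose U"
      by (simp add: T_def matrix_mul_assoc)
    also have "\<dots> = U ** (diag (\<lambda>i. sqrt (d i)) ** diag (\<lambda>i. sqrt (d i))) ** transpose U"
      by (simp add: UU matrix_mul_assoc)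
    also have "\<dots> = U ** (transpose U ** P ** U) ** transpose U"
      using dpos by (simp add: diag_mult d less_imp_le)
    also have "\<dots> = (U ** transpose U) ** P ** (U ** transpose U)"
      by (simp add: matrix_mul_assoc)
    finally show ?thesis by (simp add: UU)
  qed
  ultimately show ?thesis using that by blast
qed

lemma det_congruence: "det (transpose S ** P ** S) = det P * (det S)\<^sup>2"
  for P S :: "real^'n^'n"
  by (simp add: det_mul power2_eq_square)

lemma det_pos_def:
  fixes P :: "real^'n^'n"
  assumes "P \<in> pos_def_matrices" shows "det P > 0"
proof -
  obtain T where T: "T \<in> pos_def_matrices" "T ** T = P"
    using pos_def_sqrt[OF assms] by blast
  have "det P = (det T)\<^sup>2"
    using T by (metis det_mul power2_eq_square)
  moreover have "det T \<noteq> 0"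
    using T pos_def_invertible invertible_det_nz by blast
  ultimately show ?thesis by simp
qed

lemma diag_entry_le:
  fixes l m :: "'n::finite \<Rightarrow> real"
  assumes "diag l \<preceq> diag m" shows "l i \<le> m i"
  using assms[unfolded loewner_le_def, rule_format, of "axis i 1"] unfolding quad_axis
  by (simp add: diag_def)

lemma diag_entry_nonneg: "0 \<preceq> diag l \<Longrightarrow> 0 \<le> l i"
  unfolding loewner_le_def by (drule spec[of _ "axis i 1"]) (simp only: quad_axis, simp add: diag_def)

text \<open>Relative to \<open>P\<close>, all eigenvalues of \<open>Q\<close> are at least 1, and
  their product is the ratio of the determinants.\<close>

lemma det_mono:
  fixes P Q :: "real^'n^'n"
  assumes P: "P \<in> pos_def_matrices" and Q: "transpose Q = Q" and le: "P \<preceq> Q"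
  shows "det P \<le> det Q"
proof -
  obtain S :: "real^'n^'n" and l where S: "invertible S" and SP: "transpose S ** P ** S = mat 1"
    and SQ: "transpose S ** Q ** S = diag l"
    using simultaneous_diagonalization[OF P Q] .
  have "mat 1 \<preceq> diag l"
    using loewner_congruence[OF le, of S] SP SQ by simp
  then have "1 \<le> l i" for i
    using diag_entry_le[of "\<lambda>i. 1" l] by (simp add: diag_one)
  then have "1 \<le> (\<Prod>i\<in>UNIV. l i)"
    by (simp add: prod_ge_1)
  then have "det P * (det S)\<^sup>2 \<le> det Q * (det S)\<^sup>2"
    by (metis SP SQ det_I det_congruence det_diag)
  then show ?thesis
    using S by (simp add: invertible_det_nz)
qed

text \<open>This is \<open>ln d \<le> d - 1\<close> summed over the eigenvalues. For a matrix whose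
  diagonal entries are at most 1 it gives determinant at most 1, the form in which Hadamard's
  inequality is used.\<close>

lemma ln_det_le_trace:
  fixes X :: "real^'n^'n"
  assumes X: "X \<in> pos_def_matrices"
  shows "ln (det X) \<le> trace X - CARD('n)"
proof -
  obtain U d where U: "orthogonal_matrix U" and d: "transpose U ** X ** U = diag d"
    using spectral_theorem X by (metis pos_def_quad)
  have dpos: "d i > 0" for i
    using congruence_eq_diag_entry[OF X orthogonal_matrix_invertible[OF U] d] .
  have "trace (diag d) = trace (U ** (transpose U ** X))"
    by (metis d trace_mul_sym)
  also have "\<dots> = trace X"
    using U by (simp add: matrix_mul_assoc orthogonal_matrix_def)
  finally have tr: "trace X = (\<Sum>i\<in>UNIV. d i)"
    by (simp add: trace_diag)
  have "(det U)\<^sup>2 = 1"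
    using det_orthogonal_matrix[OF U] by auto
  then have "det X = (\<Prod>i\<in>UNIV. d i)"
    by (metis d det_congruence det_diag mult.right_neutral)
  then have "ln (det X) = (\<Sum>i\<in>UNIV. ln (d i))"
    using dpos by (simp add: ln_prod less_imp_neq[THEN not_sym])
  also have "\<dots> \<le> (\<Sum>i\<in>UNIV. d i - 1)"
    using dpos by (intro sum_mono ln_le_minus_one)
  finally show ?thesis
    by (simp add: tr sum_subtractf)
qed

subsection \<open>Expansion in the Loewner order\<close>

lemma matrix_add_rdistrib: "(A + B) ** C = A ** C + B ** C"
  for A B :: "'a::semiring_1^'n^'m"
  by (simp add: matrix_matrix_mult_def vec_eq_iff distrib_right sum.distrib)

text \<open>Evaluation at \<open>z\<close> is a ring homomorphism and so commutes with determinants;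
  this and the following lemmas bring identities between polynomial matrices down to real
  ones.\<close>

lemma poly_det: "poly (det M) z = det (map_matrix (\<lambda>p. poly p z) M)"
  for M :: "'a::comm_ring_1 poly^'n^'n"
  by (simp add: det_def poly_sum poly_prod)

lemma map_matrix_poly_mult:
  "map_matrix (\<lambda>p. poly p z) (A ** B) = map_matrix (\<lambda>p. poly p z) A ** map_matrix (\<lambda>p. poly p z) B"
  for A B :: "'a::comm_ring_1 poly^'n^'n"
  by (simp add: vec_eq_iff matrix_matrix_mult_def poly_sum)

lemma map_matrix_poly_add:
  "map_matrix (\<lambda>p. poly p z) (A + B) = map_matrix (\<lambda>p. poly p z) A + map_matrix (\<lambda>p. poly p z) B"
  by (simp add: vec_eq_iff)

lemma map_matrix_poly_diff:
  fixes A B :: "'a::comm_ring_1 poly^'n^'n"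
  shows "map_matrix (\<lambda>p. poly p z) (A - B) = map_matrix (\<lambda>p. poly p z) A - map_matrix (\<lambda>p. poly p z) B"
  by (simp add: vec_eq_iff)

lemma map_matrix_poly_mat: "map_matrix (\<lambda>p. poly p z) (mat q) = mat (poly q z)"
  by (simp add: vec_eq_iff mat_def)

lemma map_matrix_poly_const: "map_matrix (\<lambda>p. poly p z) (map_matrix (\<lambda>c. [:c:]) A) = A"
  by (simp add: vec_eq_iff)

lemma mat_vector_mult: "mat c *v v = c *\<^sub>R v" for v :: "real^'n"
  by (simp add: vec_eq_iff matrix_vector_mult_def mat_def if_distrib[of "\<lambda>x. x * _"] cong: if_cong)

lemma ex_det_mat_add_nonzero:
  fixes X :: "real^'n^'n"
  shows "\<exists>z. det (mat z + X) \<noteq> 0"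
proof
  \<comment> \<open>A number above the operator norm of \<open>X\<close> cannot be the negative of
    an eigenvalue.\<close>
  let ?z = "onorm ((*v) X) + 1"
  have "v = 0" if v: "(mat ?z + X) *v v = 0" for v
  proof (rule ccontr)
    assume "v \<noteq> 0"
    have "X *v v = - (?z *\<^sub>R v)"
      using v by (simp add: matrix_vector_mult_add_rdistrib mat_vector_mult add_eq_0_iff)
    then have "norm (X *v v) = ?z * norm v"
      by (simp add: onorm_pos_le)
    moreover have "norm (X *v v) \<le> onorm ((*v) X) * norm v"
      by (simp add: onorm)
    ultimately show False
      using \<open>v \<noteq> 0\<close> by (simp add: algebra_simps)
  qed
  then have "invertible (mat ?z + X)"
    unfolding invertible_left_inverse matrix_left_invertible_ker by blast
  then show "det (mat ?z + X) \<noteq> 0"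
    by (simp add: invertible_det_nz)
qed

text \<open>For invertible \<open>X\<close> the identity is a similarity. The general case follows by replacing \<open>X\<close> with
  \<open>X + s\<close> for an indeterminate \<open>s\<close> and cancelling \<open>det (X + s) \<noteq> 0\<close> in the ring of polynomials.\<close>

theorem sylvester_det:
  fixes X Y :: "real^'n^'n"
  shows "det (mat 1 + X ** Y) = det (mat 1 + Y ** X)"
proof -
  define c :: "real^'n^'n \<Rightarrow> real poly^'n^'n" where "c = map_matrix (\<lambda>c. [:c:])"
  define Z where "Z = mat [:0, 1:] + c X"
  obtain z where z: "det (mat z + X) \<noteq> 0"
    using ex_det_mat_add_nonzero by blast
  have "poly (det Z) z \<noteq> 0"
    using z by (simp add: Z_def c_def poly_det map_matrix_poly_add map_matrix_poly_mat map_matrix_poly_const)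
  then have nz: "det Z \<noteq> 0"
    by auto
  have "(mat 1 + Z ** c Y) ** Z = Z ** (mat 1 + c Y ** Z)"
    by (simp add: matrix_add_rdistrib matrix_add_ldistrib matrix_mul_assoc)
  then have "det (mat 1 + Z ** c Y) = det (mat 1 + c Y ** Z)"
    using nz by (metis det_mul mult.commute mult_cancel_left)
  then have "poly (det (mat 1 + Z ** c Y)) 0 = poly (det (mat 1 + c Y ** Z)) 0"
    by simp
  then show ?thesis
    by (simp add: Z_def c_def poly_det map_matrix_poly_add map_matrix_poly_mult map_matrix_poly_mat
        map_matrix_poly_const)
qed

section \<open>Common upper bounds of two forms and their determinants\<close>

lemma diag_mono: "(\<And>i. l i \<le> m i) \<Longrightarrow> diag l \<preceq> diag m"
  unfolding loewner_le_def quad_diag by (simp add: sum_mono mult_right_mono)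

lemma inverse_congruence:
  fixes S P :: "real^'n^'n"
  assumes "invertible S"
  shows "transpose (matrix_inv S) ** (transpose S ** P ** S) ** matrix_inv S = P"
proof -
  have "transpose (matrix_inv S) ** transpose S = mat 1"
    using assms by (metis matrix_inv_right matrix_transpose_mul transpose_mat)
  moreover have "transpose (matrix_inv S) ** (transpose S ** P ** S) ** matrix_inv S
      = (transpose (matrix_inv S) ** transpose S) ** P ** (S ** matrix_inv S)"
    by (simp add: matrix_mul_assoc)
  ultimately show ?thesis
    using assms by (simp add: matrix_inv_right)
qed

text \<open>By Cauchy--Schwarz the diagonal entries of the inverse of \<open>R\<close> are at most \<open>1 / max 1 (l i)\<close>,
  so the claim is Hadamard's inequality for that inverse.\<close>

lemma prod_max_le_det:
  fixes R :: "real^'n^'n"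
  assumes R: "transpose R = R" and one: "mat 1 \<preceq> R" and l: "diag l \<preceq> R" and l0: "\<And>i. 0 \<le> l i"
  shows "(\<Prod>i\<in>UNIV. max 1 (l i)) \<le> det R"
proof -
  have Rpd: "R \<in> pos_def_matrices"
    using pos_def_mono[OF pos_def_mat_1 one R] .
  note inv = pos_def_invertible[OF Rpd]
  define W where "W = matrix_inv R"
  have Wpd: "W \<in> pos_def_matrices"
    unfolding W_def by (rule pos_def_matrix_inv[OF Rpd])
  define m where "m i = max 1 (l i)" for i
  have mpos: "m i > 0" for i
    by (simp add: m_def)
  have entry: "m i * W $ i $ i \<le> 1" for i
  proof -
    \<comment> \<open>\<open>w\<close> is column \<open>i\<close> of the inverse, so
      \<open>R *v w\<close> is the unit vector and \<open>quad R w = w $ i\<close>. Testing the two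
      lower bounds for \<open>R\<close> on \<open>w\<close> bounds this entry by 1 and by
      \<open>1 / l i\<close>.\<close>
    define w where "w = W *v axis i 1"
    have wi: "w $ i = W $ i $ i"
      by (simp add: w_def matrix_vector_mult_basis column_def)
    have "quad W (axis i 1) > 0"
      using Wpd unfolding pos_def_quad by (metis axis_eq_0_iff zero_neq_one)
    then have wpos: "w $ i > 0"
      by (simp add: quad_axis wi)
    have "R *v w = axis i 1"
      using inv by (simp add: w_def W_def matrix_vector_mul_assoc matrix_inv_right)
    then have q: "quad R w = w $ i"
      by (simp add: quad_def inner_axis')
    have "(w $ i)\<^sup>2 \<le> (norm w)\<^sup>2"
      by (metis component_le_norm_cart power2_abs power_mono abs_ge_zero)
    also have "\<dots> \<le> w $ i"
      using one q by (metis loewner_le_def quad_mat_1)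
    finally have 1: "w $ i \<le> 1"
      using wpos by (simp add: power2_eq_square)
    have "l i * (w $ i)\<^sup>2 \<le> (\<Sum>j\<in>UNIV. l j * (w $ j)\<^sup>2)"
      using l0 by (intro member_le_sum) auto
    also have "\<dots> \<le> w $ i"
      using l q by (metis loewner_le_def quad_diag)
    finally have "l i * w $ i \<le> 1"
      using wpos by (simp add: power2_eq_square)
    then show ?thesis
      using 1 by (simp add: m_def wi max_def)
  qed
  \<comment> \<open>Scaling by the square roots of \<open>m\<close> brings the diagonal entries of
    the inverse down to at most 1, so the trace is at most the dimension.\<close>
  define D where "D = diag (\<lambda>i. sqrt (m i))"
  define X where "X = transpose D ** W ** D"
  have "D \<in> pos_def_matrices"
    unfolding D_def using mpos by (intro pos_def_diag) simp
  then have Xpd: "X \<in> pos_def_matrices"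
    unfolding X_def by (intro pos_def_congruence Wpd pos_def_invertible)
  have "X $ i $ i = m i * W $ i $ i" for i
  proof -
    have "X $ i $ i = quad W (D *v axis i 1)"
      by (simp add: X_def quad_congruence flip: quad_axis)
    also have "D *v axis i 1 = sqrt (m i) *\<^sub>R axis i 1"
      by (simp add: D_def vec_eq_iff diag_vector_component axis_def)
    finally show ?thesis
      using mpos[of i] by (simp add: quad_scaleR_vector quad_axis)
  qed
  then have "trace X \<le> (\<Sum>i\<in>(UNIV::'n set). 1)"
    unfolding trace_def using entry by (intro sum_mono) auto
  then have "ln (det X) \<le> 0"
    using ln_det_le_trace[OF Xpd] by simp
  then have "det X \<le> 1"
    using det_pos_def[OF Xpd] by simp
  moreover have "det X = det W * (\<Prod>i\<in>UNIV. m i)"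
    unfolding X_def det_congruence D_def det_diag prod_power_distrib
    by (simp add: mpos less_imp_le)
  moreover have "det W * det R = 1"
    unfolding W_def using inv by (metis det_I det_mul matrix_inv_left)
  ultimately have "(det W * (\<Prod>i\<in>UNIV. m i)) * det R \<le> 1 * det R" and "det W * det R = 1"
    using det_pos_def[OF Rpd] by (auto intro!: mult_right_mono)
  moreover have "(det W * (\<Prod>i\<in>UNIV. m i)) * det R = (\<Prod>i\<in>UNIV. m i) * (det W * det R)"
    by simp
  ultimately have "(\<Prod>i\<in>UNIV. m i) \<le> det R"
    by (metis mult_1_left mult_1_right)
  then show ?thesis
    by (simp add: m_def)
qed

text \<open>Stated as a bound, so that no minimum over \<open>R\<close> has to be formed. Symmetry
  of \<open>R\<close> is demanded explicitly because \<open>det R\<close> depends on more than the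
  quadratic form. \<open>Q\<close> may be singular, which admits pullbacks along singular
  Jacobians.\<close>

definition expansion_le :: "real^'n^'n \<Rightarrow> real^'n^'n \<Rightarrow> real \<Rightarrow> bool" where
  "expansion_le P Q c \<longleftrightarrow> (\<exists>R. transpose R = R \<and> P \<preceq> R \<and> Q \<preceq> R \<and> det R \<le> c * det P)"

text \<open>Where \<open>P\<close> is the identity and \<open>Q\<close> is diagonal, the best common
  upper bound is the diagonal matrix with entries \<open>max 1 (l i)\<close>; its optimality is
  \<open>prod_max_le_det\<close>.\<close>

lemma expansion_le_diag:
  fixes P Q S :: "real^'n^'n"
  assumes P: "P \<in> pos_def_matrices" and Q: "0 \<preceq> Q" and S: "invertible S"
    and SP: "transpose S ** P ** S = mat 1" and SQ: "transpose S ** Q ** S = diag l"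
  shows "expansion_le P Q c \<longleftrightarrow> (\<Prod>i\<in>UNIV. max 1 (l i)) \<le> c"
proof -
  have detS: "(det S)\<^sup>2 > 0"
    using S by (simp add: invertible_det_nz)
  have detP: "det P * (det S)\<^sup>2 = 1"
    using det_congruence[of S P] by (simp add: SP)
  have l0: "0 \<le> l i" for i
    using loewner_congruence[OF Q, of S] by (intro diag_entry_nonneg) (simp add: SQ)
  show ?thesis
  proof
    assume "expansion_le P Q c"
    then obtain R where R: "transpose R = R" "P \<preceq> R" "Q \<preceq> R" and det: "det R \<le> c * det P"
      unfolding expansion_le_def by blast
    have "(\<Prod>i\<in>UNIV. max 1 (l i)) \<le> det (transpose S ** R ** S)"
      using loewner_congruence[OF R(2), of S] loewner_congruence[OF R(3), of S] l0
      by (intro prod_max_le_det transpose_congruence R) (simp_all add: SP SQ)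
    also have "\<dots> \<le> c * (det P * (det S)\<^sup>2)"
      using det detS by (simp add: det_congruence mult.assoc[symmetric])
    finally show "(\<Prod>i\<in>UNIV. max 1 (l i)) \<le> c"
      by (simp add: detP)
  next
    assume c: "(\<Prod>i\<in>UNIV. max 1 (l i)) \<le> c"
    define D where "D = diag (\<lambda>i. max 1 (l i))"
    define R where "R = transpose (matrix_inv S) ** D ** matrix_inv S"
    have "mat 1 \<preceq> D" "diag l \<preceq> D"
      unfolding D_def by (auto intro: diag_mono simp flip: diag_one)
    then have "P \<preceq> R" "Q \<preceq> R"
      using loewner_congruence[of _ D "matrix_inv S"] inverse_congruence[OF S, of P]
        inverse_congruence[OF S, of Q] unfolding R_def SP SQ by fastforce+
    moreover have "transpose R = R"
      unfolding R_def by (rule transpose_congruence) (simp add: D_def transpose_diag)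
    moreover have "det R \<le> c * det P"
    proof -
      have "(det (matrix_inv S))\<^sup>2 * (det S)\<^sup>2 = 1"
        using det_mul[of "matrix_inv S" S] matrix_inv_left[OF S] by (simp flip: power_mult_distrib)
      then have "(det (matrix_inv S))\<^sup>2 * (det S)\<^sup>2 = det P * (det S)\<^sup>2"
        by (simp only: detP)
      then have "(det (matrix_inv S))\<^sup>2 = det P"
        using detS by simp
      then have "det R = (\<Prod>i\<in>UNIV. max 1 (l i)) * det P"
        by (simp add: R_def det_congruence D_def det_diag)
      then show ?thesis
        using c det_pos_def[OF P] by simp
    qed
    ultimately show "expansion_le P Q c"
      unfolding expansion_le_def by blast
  qed
qed

text \<open>A matrix and its transpose have the same operator norm. Below, Sylvester's identity
  exchanges the two products, and this carries the bound along.\<close>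

lemma loewner_transpose_contraction:
  fixes B :: "real^'n^'n"
  assumes "transpose B ** B \<preceq> mat 1"
  shows "B ** transpose B \<preceq> mat 1"
proof -
  have B: "norm (B *v v) \<le> norm v" for v
    using assms unfolding loewner_le_def quad_transpose_mult quad_mat_1 by (simp add: power2_le_iff_abs_le)
  have "norm (transpose B *v v) \<le> norm v" for v
  proof -
    define w where "w = transpose B *v v"
    have "norm w * norm w = (B *v w) \<bullet> v"
      by (simp add: w_def inner_matrix_vector power2_norm_eq_inner flip: power2_eq_square del: transpose_matrix_vector)
    also have "\<dots> \<le> norm (B *v w) * norm v"
      by (rule norm_cauchy_schwarz)
    also have "\<dots> \<le> norm w * norm v"
      using B by (intro mult_right_mono) auto
    finally show ?thesis
      by (cases "w = 0") (auto simp: w_def)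
  qed
  then show ?thesis
    using quad_transpose_mult[of "transpose B"] by (simp add: loewner_le_def quad_mat_1 power_mono del: transpose_matrix_vector)
qed

text \<open>In coordinates where \<open>P\<close> and \<open>R\<close> become identities,
  \<open>A\<close> becomes a contraction \<open>B\<close> and the claim compares
  \<open>1 + B\<^sup>T d B\<close> with \<open>1 + d\<close>. For \<open>E\<close> the root of
  \<open>diag d\<close>, Sylvester's identity turns the former determinant into that of
  \<open>1 + E B B\<^sup>T E\<close>, and \<open>B B\<^sup>T\<close> is at most the
  identity.\<close>

lemma det_add_congruence_le:
  fixes A P D R :: "real^'n^'n"
  assumes P: "P \<in> pos_def_matrices" and R: "R \<in> pos_def_matrices"
    and D: "transpose D = D" "0 \<preceq> D" and le: "transpose A ** P ** A \<preceq> R"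
  shows "det (R + transpose A ** D ** A) * det P \<le> det R * det (P + D)"
proof -
  obtain S :: "real^'n^'n" and d where S: "invertible S" and SP: "transpose S ** P ** S = mat 1"
    and SD: "transpose S ** D ** S = diag d"
    using simultaneous_diagonalization[OF P D(1)] .
  have "transpose R = R"
    using R by (simp add: pos_def_quad)
  then obtain T :: "real^'n^'n" where T: "invertible T" and TR: "transpose T ** R ** T = mat 1"
    using simultaneous_diagonalization[OF R] by blast
  have d0: "0 \<le> d i" for i
    using loewner_congruence[OF D(2), of S] by (intro diag_entry_nonneg) (simp add: SD)
  define B where "B = matrix_inv S ** A ** T"
  define E where "E = diag (\<lambda>i. sqrt (d i))"
  have EE: "E ** E = diag d" "transpose E = E"
    using d0 by (simp_all add: E_def diag_mult transpose_diag)
  have cong: "transpose T ** (transpose A ** M ** A) ** T = transpose B ** (transpose S ** M ** S) ** B" for M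
  proof -
    have "transpose B ** (transpose S ** M ** S) ** B = transpose T ** (transpose A **
        (transpose (matrix_inv S) ** (transpose S ** M ** S) ** matrix_inv S) ** A) ** T"
      by (simp add: B_def matrix_transpose_mul matrix_mul_assoc)
    then show ?thesis
      by (simp add: inverse_congruence[OF S])
  qed
  have "transpose B ** B \<preceq> mat 1"
    using loewner_congruence[OF le, of T] by (simp add: TR cong SP)
  then have "transpose E ** (B ** transpose B) ** E \<preceq> transpose E ** mat 1 ** E"
    by (intro loewner_congruence loewner_transpose_contraction)
  then have le1: "E ** B ** transpose B ** E \<preceq> diag d"
    by (simp add: EE matrix_mul_assoc)
  have "det (R + transpose A ** D ** A) * (det T)\<^sup>2 = det (mat 1 + transpose B ** diag d ** B)"
    unfolding det_congruence[symmetric]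
    by (simp add: matrix_add_ldistrib matrix_add_rdistrib TR cong SD)
  also have "\<dots> = det (mat 1 + transpose B ** E ** (E ** B))"
    by (simp add: matrix_mul_assoc flip: EE(1))
  also have "\<dots> = det (mat 1 + E ** B ** (transpose B ** E))"
    by (rule sylvester_det)
  also have "\<dots> \<le> det (mat 1 + diag d)"
  proof (rule det_mono)
    have sym: "transpose (E ** B ** (transpose B ** E)) = E ** B ** (transpose B ** E)"
      by (simp add: matrix_transpose_mul EE)
    have "quad (E ** B ** (transpose B ** E)) v = (norm (transpose (E ** B) *v v))\<^sup>2" for v
      by (simp add: EE matrix_transpose_mul flip: quad_transpose_mult)
    then have "0 \<preceq> E ** B ** (transpose B ** E)"
      by (simp add: loewner_le_def quad_def[of 0])
    then show "mat 1 + E ** B ** (transpose B ** E) \<in> pos_def_matrices"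
      using sym by (intro pos_def_mono[OF pos_def_mat_1]) (auto simp: loewner_le_def quad_add transpose_add quad_def[of 0])
    show "transpose (mat 1 + diag d) = mat 1 + diag d"
      by (simp add: transpose_add transpose_diag)
    show "mat 1 + E ** B ** (transpose B ** E) \<preceq> mat 1 + diag d"
      using le1 by (simp add: loewner_le_def quad_add matrix_mul_assoc)
  qed
  also have "\<dots> = det (P + D) * (det S)\<^sup>2"
    unfolding det_congruence[symmetric] by (simp add: matrix_add_ldistrib matrix_add_rdistrib SP SD)
  finally have "det (R + transpose A ** D ** A) * (det T)\<^sup>2 \<le> det (P + D) * (det S)\<^sup>2" .
  then have "(det (R + transpose A ** D ** A) * (det T)\<^sup>2) * (det R * det P) \<le> (det (P + D) * (det S)\<^sup>2) * (det R * det P)"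
    using det_pos_def[OF P] det_pos_def[OF R] by (intro mult_right_mono) auto
  moreover have "det P * (det S)\<^sup>2 = 1" "det R * (det T)\<^sup>2 = 1"
    using det_congruence[of S P] det_congruence[of T R] by (simp_all add: SP TR)
  moreover have "(det (R + transpose A ** D ** A) * (det T)\<^sup>2) * (det R * det P)
      = (det (R + transpose A ** D ** A) * det P) * (det R * (det T)\<^sup>2)"
    "(det (P + D) * (det S)\<^sup>2) * (det R * det P) = (det R * det (P + D)) * (det P * (det S)\<^sup>2)"
    by simp_all
  ultimately show ?thesis
    by simp
qed

text \<open>If \<open>R\<close> and \<open>R'\<close> are witnesses for the two steps, then
  \<open>R\<close> plus the pullback of the excess \<open>R' - P'\<close> is one for the
  composition. Since \<open>R\<close> already dominates the pullback of \<open>P'\<close>, adding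
  just the excess suffices, and \<open>det_add_congruence_le\<close> keeps the determinant
  multiplicative.\<close>

lemma expansion_le_trans:
  fixes A P P' Q :: "real^'n^'n"
  assumes P: "P \<in> pos_def_matrices" and P': "P' \<in> pos_def_matrices"
    and 1: "expansion_le P (transpose A ** P' ** A) c" and 2: "expansion_le P' Q d"
  shows "expansion_le P (transpose A ** Q ** A) (c * d)"
proof -
  obtain R where R: "transpose R = R" "P \<preceq> R" "transpose A ** P' ** A \<preceq> R" "det R \<le> c * det P"
    using 1 unfolding expansion_le_def by blast
  obtain R' where R': "transpose R' = R'" "P' \<preceq> R'" "Q \<preceq> R'" "det R' \<le> d * det P'"
    using 2 unfolding expansion_le_def by blast
  have pd: "R \<in> pos_def_matrices" "R' \<in> pos_def_matrices"
    using pos_def_mono P P' R R' by blast+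
  define D where "D = R' - P'"
  have D: "transpose D = D" "0 \<preceq> D"
    using R' P' by (auto simp: D_def transpose_diff pos_def_quad loewner_le_def quad_diff quad_def[of 0])
  define T where "T = R + transpose A ** D ** A"
  have "transpose T = T"
    by (simp add: T_def transpose_add R transpose_congruence D)
  moreover have "P \<preceq> T"
    using R(2) D(2) by (auto simp: T_def loewner_le_def quad_add quad_congruence quad_def[of 0] intro: add_increasing2)
  moreover have "transpose A ** Q ** A \<preceq> T"
    unfolding loewner_le_def
  proof
    fix v
    have "quad (transpose A ** Q ** A) v \<le> quad R' (A *v v)"
      using R' by (simp add: quad_congruence loewner_le_def)
    also have "\<dots> = quad (transpose A ** P' ** A) v + quad (transpose A ** D ** A) v"
      by (simp add: quad_congruence D_def quad_diff)
    also have "\<dots> \<le> quad T v"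
      using R(3) by (simp add: T_def quad_add loewner_le_def)
    finally show "quad (transpose A ** Q ** A) v \<le> quad T v" .
  qed
  moreover have "det T \<le> c * d * det P"
  proof -
    have "det T * det P' \<le> det R * det R'"
      using det_add_congruence_le[OF P' pd(1) D R(3)] by (simp add: T_def D_def)
    also have "\<dots> \<le> (c * det P) * (d * det P')"
      using R R' det_pos_def pd by (intro mult_mono) (auto intro: less_imp_le order_trans)
    also have "\<dots> = (c * d * det P) * det P'"
      by simp
    finally show ?thesis
      using det_pos_def[OF P'] by simp
  qed
  ultimately show ?thesis
    unfolding expansion_le_def by blast
qed

subsection \<open>Singular values in a metric\<close>

lemma metric_adjoint_eq:
  fixes P Q A :: "real^'n^'n"
  assumes P: "P \<in> pos_def_matrices" and Q: "Q \<in> pos_def_matrices"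
  shows "metric_adjoint P Q A = matrix_inv P ** transpose A ** Q"
  unfolding metric_adjoint_def
proof (rule the_equality)
  have P': "transpose P = P" "invertible P" and Q': "transpose Q = Q"
    using P Q pos_def_invertible by (auto simp: pos_def_quad)
  have move: "metric_inner Q (A *v v) w = v \<bullet> (transpose A ** Q *v w)" for v w
    by (simp add: metric_inner_def inner_matrix_vector matrix_vector_mul_assoc matrix_transpose_mul Q' del: transpose_matrix_vector)
  have move': "metric_inner P v (B *v w) = v \<bullet> (P ** B *v w)" for v w B
    by (simp add: metric_inner_def inner_matrix_vector matrix_vector_mul_assoc matrix_transpose_mul P' del: transpose_matrix_vector)
  show "\<forall>v w. metric_inner Q (A *v v) w = metric_inner P v ((matrix_inv P ** transpose A ** Q) *v w)"
    unfolding move move' using P'(2) by (simp add: matrix_inv_cancel flip: matrix_mul_assoc)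
  fix B
  assume "\<forall>v w. metric_inner Q (A *v v) w = metric_inner P v (B *v w)"
  then have "transpose A ** Q *v w = P ** B *v w" for w
    unfolding move move' by (metis vector_eq_ldot)
  then have "transpose A ** Q = P ** B"
    by (simp add: matrix_eq)
  then show "B = matrix_inv P ** transpose A ** Q"
    using P'(2) by (metis matrix_inv_cancel(2) matrix_mul_assoc)
qed

lemma matrix_diff_ldistrib: "C ** (A - B) = C ** A - C ** B"
  and matrix_diff_rdistrib: "(A - B) ** C = A ** C - B ** C"
  for A B C :: "'a::ring_1^'n^'n"
  by (simp_all add: matrix_matrix_mult_def vec_eq_iff left_diff_distrib right_diff_distrib sum_subtractf)

lemma poly_charpoly: "poly (charpoly A) z = det (mat z - A)"
  by (simp add: charpoly_def poly_det map_matrix_poly_diff map_matrix_poly_mat map_matrix_poly_const)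

lemma charpoly_similar:
  fixes A S :: "real^'n^'n"
  assumes "invertible S"
  shows "charpoly (S ** A ** matrix_inv S) = charpoly A"
proof -
  have "det (mat z - S ** A ** matrix_inv S) = det (mat z - A)" for z
  proof -
    have "mat z ** S = S ** mat z"
      by (simp add: matrix_eq mat_vector_mult flip: matrix_vector_mul_assoc)
        (simp add: matrix_vector_mult_scaleR)
    then have "(mat z - S ** A ** matrix_inv S) ** S = S ** (mat z - A)"
      using assms by (simp add: matrix_diff_rdistrib matrix_diff_ldistrib matrix_inv_cancel)
    then have "det (mat z - S ** A ** matrix_inv S) * det S = det S * det (mat z - A)"
      by (metis det_mul)
    then show ?thesis
      using assms by (simp add: invertible_det_nz)
  qed
  then show ?thesis
    by (simp add: poly_charpoly fun_eq_iff flip: poly_eq_poly_eq_iff)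
qed

lemma charpoly_diag: "charpoly (diag l) = (\<Prod>i\<in>UNIV. [:- l i, 1:])"
proof -
  have "mat z - diag l = diag (\<lambda>i. z - l i)" for z
    by (simp add: mat_def diag_def vec_eq_iff)
  then show ?thesis
    by (simp add: poly_charpoly fun_eq_iff poly_prod det_diag flip: poly_eq_poly_eq_iff)
qed

lemma proots_charpoly_diag: "proots (charpoly (diag l)) = image_mset l (mset_set UNIV)"
proof -
  have "(\<Sum>i\<in>I. {#l i#}) = image_mset l (mset_set I)" if "finite I" for I
    using that by induction auto
  then show ?thesis
    unfolding charpoly_diag by (subst proots_prod) auto
qed

text \<open>Summation ignores the order of the list, so only the multiset of roots counts. By
  \<open>SP\<close> the inverse of \<open>P\<close> is \<open>S ** transpose S\<close>, which makes
  \<open>metric_adjoint P Q A ** A\<close> similar to \<open>diag l\<close> through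
  \<open>S\<close>.\<close>

lemma sum_nth_metric_singular_values:
  fixes g :: "real \<Rightarrow> ereal" and P Q A S :: "real^'n^'n"
  assumes P: "P \<in> pos_def_matrices" and Q: "Q \<in> pos_def_matrices" and S: "invertible S"
    and SP: "transpose S ** P ** S = mat 1" and SQ: "transpose S ** (transpose A ** Q ** A) ** S = diag l"
  shows "(\<Sum>i = 1..CARD('n). g (metric_singular_values P Q A ! (i - 1))) = (\<Sum>i\<in>UNIV. g (sqrt (l i)))"
proof -
  have "S ** transpose S ** P = mat 1"
  proof -
    have "S ** (transpose S ** P ** S) ** matrix_inv S = mat 1"
      using S by (simp add: SP matrix_inv_right)
    then show ?thesis
      using S by (simp add: matrix_mul_assoc matrix_inv_cancel)
  qed
  then have Pinv: "matrix_inv P = S ** transpose S"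
    by (metis matrix_inv_unique matrix_left_right_inverse)
  have "metric_adjoint P Q A ** A = S ** (transpose S ** (transpose A ** Q ** A) ** S) ** matrix_inv S"
    using S by (simp add: metric_adjoint_eq[OF P Q] Pinv matrix_mul_assoc matrix_inv_cancel)
  then have "proots (charpoly (metric_adjoint P Q A ** A)) = image_mset l (mset_set UNIV)"
    by (simp add: SQ charpoly_similar[OF S] proots_charpoly_diag)
  then have mset: "mset (metric_singular_values P Q A) = image_mset (\<lambda>i. sqrt (l i)) (mset_set UNIV)"
    by (simp add: metric_singular_values_def image_mset.compositionality comp_def)
  then have len: "length (metric_singular_values P Q A) = CARD('n)"
    by (metis size_mset size_image_mset size_mset_set)
  have "(\<Sum>i = 1..CARD('n). g (metric_singular_values P Q A ! (i - 1)))
      = (\<Sum>i<CARD('n). g (metric_singular_values P Q A ! i))"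
    by (rule sum.reindex_bij_witness[of _ Suc "\<lambda>i. i - 1"]) auto
  also have "\<dots> = sum_list (map g (metric_singular_values P Q A))"
    by (simp add: sum_list_sum_nth len lessThan_atLeast0)
  also have "\<dots> = sum_mset (image_mset g (mset (metric_singular_values P Q A)))"
    by (metis mset_map sum_mset_sum_list)
  also have "\<dots> = (\<Sum>i\<in>UNIV. g (sqrt (l i)))"
    by (simp add: mset image_mset.compositionality comp_def sum_unfold_sum_mset)
  finally show ?thesis .
qed

text \<open>At \<open>x = 0\<close> the left side is the maximum of 0 and -\<infinity>, in agreement
  with \<open>log 4 1\<close>.\<close>

lemma max_0_elog2_sqrt: "0 \<le> x \<Longrightarrow> max 0 (elog2 (sqrt x)) = ereal (log 4 (max 1 x))"
proof -
  assume x: "0 \<le> x"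
  have "log 4 y = log 2 (sqrt y)" if "y > 0" for y :: real
  proof -
    have "ln (4::real) = 2 * ln 2"
      using ln_realpow[of 2 2] by simp
    then show ?thesis
      using that by (simp add: log_def ln_sqrt)
  qed
  then show ?thesis
    using x by (auto simp: elog2_def max_def log_def field_simps)
qed

text \<open>The factor between the base \<open>4\<close> and the base \<open>2\<close> of the entropy is the square root in the
  definition of the singular values.\<close>

lemma Sigma_metric_le_iff:
  fixes P :: "real^'n \<Rightarrow> real^'n^'n"
  assumes P: "P x \<in> pos_def_matrices" and Q: "P (f x) \<in> pos_def_matrices"
  defines "J \<equiv> jacobian f (at x)"
  shows "\<exists>s\<ge>0. Sigma_metric P f x = ereal s"
    and "Sigma_metric P f x \<le> ereal s \<longleftrightarrow> expansion_le (P x) (transpose J ** P (f x) ** J) (4 powr s)"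
proof -
  let ?Q = "transpose J ** P (f x) ** J"
  have Q0: "0 \<preceq> ?Q"
    using loewner_congruence[OF pos_def_nonneg[OF Q], of J] by simp
  have "transpose ?Q = ?Q"
    using Q by (intro transpose_congruence) (simp add: pos_def_quad)
  then obtain S :: "real^'n^'n" and l where S: "invertible S"
      "transpose S ** P x ** S = mat 1" "transpose S ** ?Q ** S = diag l"
    using simultaneous_diagonalization[OF P] by metis
  have l0: "0 \<le> l i" for i
    using loewner_congruence[OF Q0, of S] by (intro diag_entry_nonneg) (simp add: S(3))
  define p where "p = (\<Prod>i\<in>UNIV. max 1 (l i))"
  have p1: "1 \<le> p"
    unfolding p_def by (rule prod_ge_1) auto
  have "Sigma_metric P f x = (\<Sum>i\<in>UNIV. max 0 (elog2 (sqrt (l i))))"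
    unfolding Sigma_metric_def alpha_def J_def[symmetric]
    by (rule sum_nth_metric_singular_values[OF P Q S])
  also have "\<dots> = ereal (\<Sum>i\<in>UNIV. log 4 (max 1 (l i)))"
    by (simp add: max_0_elog2_sqrt l0)
  also have "(\<Sum>i\<in>UNIV. log 4 (max 1 (l i))) = log 4 p"
    unfolding p_def log_def by (subst ln_prod) (auto simp: sum_divide_distrib max_def)
  finally have sigma: "Sigma_metric P f x = ereal (log 4 p)" .
  then show "\<exists>s\<ge>0. Sigma_metric P f x = ereal s"
    using p1 by auto
  show "Sigma_metric P f x \<le> ereal s \<longleftrightarrow> expansion_le (P x) ?Q (4 powr s)"
    using p1 by (simp add: sigma expansion_le_diag[OF P Q0 S] log_le_iff flip: p_def)
qed

subsection \<open>Geometric means of positive definite matrices\<close>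

lemma loewner_antisym:
  fixes A B :: "real^'n^'n"
  assumes "A \<preceq> B" "B \<preceq> A" "transpose A = A" "transpose B = B"
  shows "A = B"
  by (rule symmetric_matrix_eqI) (use assms in \<open>simp_all add: loewner_le_def order_antisym\<close>)

lemma loewner_congruence_iff:
  fixes A B M :: "real^'n^'n"
  assumes "invertible M"
  shows "transpose M ** A ** M \<preceq> transpose M ** B ** M \<longleftrightarrow> A \<preceq> B"
  using loewner_congruence[of "transpose M ** A ** M" "transpose M ** B ** M" "matrix_inv M"]
    loewner_congruence[of A B M] by (auto simp: inverse_congruence[OF assms])

text \<open>Diagonalizing \<open>X\<close> relative to \<open>Y\<close> reduces the hypothesis to
  \<open>diag m ** C ** diag m \<preceq> C\<close>. The axes are eigenvectors of
  \<open>diag m\<close>, so evaluating there gives \<open>(m i)\<^sup>2 \<le> 1\<close>. Uniqueness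
  and monotonicity of the geometric mean both follow from this.\<close>

lemma riccati_mono:
  fixes A X Y :: "real^'n^'n"
  assumes A: "A \<in> pos_def_matrices" and X: "X \<in> pos_def_matrices" and Y: "Y \<in> pos_def_matrices"
    and le: "X ** matrix_inv A ** X \<preceq> Y ** matrix_inv A ** Y"
  shows "X \<preceq> Y"
proof -
  have "transpose X = X"
    using X by (simp add: pos_def_quad)
  then obtain S :: "real^'n^'n" and m where S: "invertible S" and SY: "transpose S ** Y ** S = mat 1"
    and SX: "transpose S ** X ** S = diag m"
    using simultaneous_diagonalization[OF Y] by metis
  have mpos: "m i > 0" for i
    using congruence_eq_diag_entry[OF X S SX] .
  \<comment> \<open>The inverse of \<open>transpose S ** A ** S\<close>; the double transpose puts
    it into the shape of a congruence, which shows positive definiteness.\<close>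
  define C where "C = transpose (transpose (matrix_inv S)) ** matrix_inv A ** transpose (matrix_inv S)"
  have Cpd: "C \<in> pos_def_matrices"
    unfolding C_def using S A
    by (intro pos_def_congruence pos_def_matrix_inv invertible_transpose invertible_matrix_inv)
  have cong: "transpose S ** (Z ** matrix_inv A ** Z) ** S = (transpose S ** Z ** S) ** C ** (transpose S ** Z ** S)" for Z
  proof -
    have "transpose (matrix_inv S) ** transpose S = mat 1"
      using S by (metis matrix_inv_right matrix_transpose_mul transpose_mat)
    moreover have "(transpose S ** Z ** S) ** C ** (transpose S ** Z ** S)
       = transpose S ** Z ** (S ** matrix_inv S) ** matrix_inv A ** (transpose (matrix_inv S) ** transpose S) ** Z ** S"
      by (simp add: C_def matrix_mul_assoc)
    ultimately show ?thesis
      using S by (simp add: matrix_inv_right matrix_mul_assoc)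
  qed
  have le': "transpose (diag m) ** C ** diag m \<preceq> C"
    using loewner_congruence[OF le, of S] by (simp add: cong SX SY transpose_diag)
  have "m i \<le> 1" for i
  proof -
    have "quad C (diag m *v axis i 1) \<le> quad C (axis i 1)"
      using le' by (metis loewner_le_def quad_congruence)
    moreover have "diag m *v axis i 1 = m i *\<^sub>R axis i 1"
      by (simp add: vec_eq_iff diag_vector_component axis_def)
    ultimately have "(m i)\<^sup>2 * quad C (axis i 1) \<le> 1 * quad C (axis i 1)"
      by (simp add: quad_scaleR_vector)
    moreover have "quad C (axis i 1) > 0"
      using Cpd unfolding pos_def_quad by (metis axis_eq_0_iff zero_neq_one)
    ultimately have "(m i)\<^sup>2 \<le> 1"
      by (simp only: mult_le_cancel_right_pos)
    then show ?thesis
      using abs_square_le_1 abs_le_D1 by blast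
  qed
  then have "diag m \<preceq> mat 1"
    unfolding diag_one[symmetric] by (rule diag_mono)
  then show ?thesis
    using loewner_congruence_iff[OF S, of X Y] by (simp add: SX SY)
qed

text \<open>The metric geometric mean \<open>A # B = A\<^sup>1\<^sup>/\<^sup>2
  (A\<^sup>-\<^sup>1\<^sup>/\<^sup>2 B A\<^sup>-\<^sup>1\<^sup>/\<^sup>2)\<^sup>1\<^sup>/\<^sup>2
  A\<^sup>1\<^sup>/\<^sup>2\<close>, introduced through its Riccati equation so that its properties
  reduce to \<open>riccati_mono\<close>. The formula serves only for existence.\<close>

definition gmean :: "real^'n^'n \<Rightarrow> real^'n^'n \<Rightarrow> real^'n^'n" where
  "gmean A B = (SOME X. X \<in> pos_def_matrices \<and> X ** matrix_inv A ** X = B)"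

lemma gmean:
  fixes A B :: "real^'n^'n"
  assumes A: "A \<in> pos_def_matrices" and B: "B \<in> pos_def_matrices"
  shows "gmean A B \<in> pos_def_matrices" "gmean A B ** matrix_inv A ** gmean A B = B"
proof -
  obtain T where T: "T \<in> pos_def_matrices" "T ** T = A"
    using pos_def_sqrt[OF A] by blast
  have inv: "invertible T" and sym: "transpose T = T"
    using T pos_def_invertible by (auto simp: pos_def_quad)
  define M where "M = transpose (matrix_inv T) ** B ** matrix_inv T"
  have "M \<in> pos_def_matrices"
    unfolding M_def using B inv by (intro pos_def_congruence invertible_matrix_inv)
  then obtain Y where Y: "Y \<in> pos_def_matrices" "Y ** Y = M"
    using pos_def_sqrt by blast
  define X where "X = transpose T ** Y ** T"
  have "X \<in> pos_def_matrices"
    unfolding X_def using Y inv by (intro pos_def_congruence)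
  moreover have "X ** matrix_inv A ** X = B"
  proof -
    have "matrix_inv A = matrix_inv T ** matrix_inv T"
      using matrix_inv_mult[OF inv inv] T by simp
    then have "X ** matrix_inv A ** X = T ** Y ** (T ** matrix_inv T) ** (matrix_inv T ** T) ** Y ** T"
      by (simp add: X_def sym matrix_mul_assoc)
    also have "\<dots> = transpose T ** (Y ** Y) ** T"
      using inv by (simp add: matrix_inv_left matrix_inv_right matrix_mul_assoc sym)
    also have "\<dots> = B"
    proof -
      have "transpose T ** transpose (matrix_inv T) = mat 1"
        using inv by (metis matrix_inv_left matrix_transpose_mul transpose_mat)
      moreover have "transpose T ** M ** T = (transpose T ** transpose (matrix_inv T)) ** B ** (matrix_inv T ** T)"
        by (simp add: M_def matrix_mul_assoc)
      ultimately show ?thesis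
        using inv by (simp add: Y matrix_inv_left)
    qed
    finally show ?thesis .
  qed
  ultimately have "\<exists>X. X \<in> pos_def_matrices \<and> X ** matrix_inv A ** X = B"
    by blast
  then show "gmean A B \<in> pos_def_matrices" "gmean A B ** matrix_inv A ** gmean A B = B"
    unfolding gmean_def by (metis (mono_tags, lifting) someI_ex)+
qed

lemma gmean_unique:
  fixes A X :: "real^'n^'n"
  assumes A: "A \<in> pos_def_matrices" and X: "X \<in> pos_def_matrices" and B: "B \<in> pos_def_matrices"
    and eq: "X ** matrix_inv A ** X = B"
  shows "gmean A B = X"
proof (rule loewner_antisym)
  show "gmean A B \<preceq> X" "X \<preceq> gmean A B"
    by (rule riccati_mono[OF A]; simp add: gmean[OF A B] X eq loewner_refl)+
qed (use gmean(1)[OF A B] X in \<open>auto simp: pos_def_quad\<close>)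

text \<open>Inverting both sides of the Riccati equation for \<open>A\<close> and \<open>B\<close>
  gives the one with the roles of \<open>A\<close> and \<open>B\<close> exchanged.\<close>

lemma gmean_commute:
  fixes A B :: "real^'n^'n"
  assumes A: "A \<in> pos_def_matrices" and B: "B \<in> pos_def_matrices"
  shows "gmean A B = gmean B A"
proof -
  define X where "X = gmean A B"
  have X: "X \<in> pos_def_matrices" "X ** matrix_inv A ** X = B"
    using gmean[OF A B] by (auto simp: X_def)
  have inv: "invertible X" "invertible A" "invertible (matrix_inv A)"
    using X A pos_def_invertible invertible_matrix_inv by blast+
  have "matrix_inv B = matrix_inv (X ** (matrix_inv A ** X))"
    using X by (simp add: matrix_mul_assoc)
  also have "\<dots> = matrix_inv X ** matrix_inv (matrix_inv A) ** matrix_inv X"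
    using inv by (simp add: matrix_inv_mult invertible_mult)
  also have "matrix_inv (matrix_inv A) = A"
    using inv by (intro matrix_inv_unique matrix_inv_left)
  finally have "X ** matrix_inv B ** X = (X ** matrix_inv X) ** A ** (matrix_inv X ** X)"
    by (simp add: matrix_mul_assoc)
  then have "X ** matrix_inv B ** X = A"
    using inv by (simp add: matrix_inv_left matrix_inv_right)
  then show ?thesis
    using gmean_unique[OF B X(1) A] by (simp add: X_def)
qed

lemma gmean_mono_right:
  fixes A B C :: "real^'n^'n"
  assumes "A \<in> pos_def_matrices" "B \<in> pos_def_matrices" "C \<in> pos_def_matrices" "B \<preceq> C"
  shows "gmean A B \<preceq> gmean A C"
  by (rule riccati_mono[of A]) (simp_all add: assms gmean)

lemma gmean_mono:
  fixes A B C D :: "real^'n^'n"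
  assumes "A \<in> pos_def_matrices" "B \<in> pos_def_matrices" "C \<in> pos_def_matrices" "D \<in> pos_def_matrices"
    and "A \<preceq> C" "B \<preceq> D"
  shows "gmean A B \<preceq> gmean C D"
  using gmean_mono_right[of A B D] gmean_mono_right[of D A C] assms
  by (simp add: gmean_commute[of A D] gmean_commute[of C D]) (rule loewner_trans)

text \<open>The Riccati equation is covariant under congruence. Hence the pullback of a mean is the
  mean of the pullbacks.\<close>

lemma gmean_congruence:
  fixes A B M :: "real^'n^'n"
  assumes A: "A \<in> pos_def_matrices" and B: "B \<in> pos_def_matrices" and M: "invertible M"
  shows "gmean (transpose M ** A ** M) (transpose M ** B ** M) = transpose M ** gmean A B ** M"
proof (rule gmean_unique)
  have M': "invertible (transpose M)" and A': "invertible A"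
    using M A by (auto intro: invertible_transpose pos_def_invertible)
  have "matrix_inv (transpose M ** A ** M) = matrix_inv M ** matrix_inv A ** matrix_inv (transpose M)"
    using M M' A' by (simp add: matrix_inv_mult invertible_mult matrix_mul_assoc)
  then have "(transpose M ** gmean A B ** M) ** matrix_inv (transpose M ** A ** M) ** (transpose M ** gmean A B ** M)
      = transpose M ** gmean A B ** (M ** matrix_inv M) ** matrix_inv A ** (matrix_inv (transpose M) ** transpose M)
        ** gmean A B ** M"
    by (simp add: matrix_mul_assoc)
  also have "\<dots> = transpose M ** (gmean A B ** matrix_inv A ** gmean A B) ** M"
    using M M' by (simp add: matrix_inv_left matrix_inv_right matrix_mul_assoc)
  finally show "(transpose M ** gmean A B ** M) ** matrix_inv (transpose M ** A ** M) ** (transpose M ** gmean A B ** M)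
      = transpose M ** B ** M"
    by (simp add: gmean[OF A B])
qed (use assms gmean(1) in \<open>auto intro: pos_def_congruence\<close>)

lemma gmean_scaleR:
  fixes A B :: "real^'n^'n"
  assumes A: "A \<in> pos_def_matrices" and B: "B \<in> pos_def_matrices" and c: "0 < c"
  shows "gmean (c *\<^sub>R A) (c *\<^sub>R B) = c *\<^sub>R gmean A B"
proof -
  have eq: "transpose (mat (sqrt c)) ** X ** mat (sqrt c) = c *\<^sub>R X" for X :: "real^'n^'n"
    using c by (simp add: matrix_eq mat_vector_mult matrix_vector_mult_scaleR transpose_mat
        flip: matrix_vector_mul_assoc scaleR_matrix_vector_assoc)
  have "det (mat (sqrt c) :: real^'n^'n) \<noteq> 0"
    using c by (subst det_diagonal) (auto simp: mat_def)
  then show ?thesis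
    using gmean_congruence[OF A B, of "mat (sqrt c)"] by (simp add: eq invertible_det_nz del: transpose_mat)
qed

lemma det_gmean:
  fixes A B :: "real^'n^'n"
  assumes A: "A \<in> pos_def_matrices" and B: "B \<in> pos_def_matrices"
  shows "det (gmean A B) = sqrt (det A * det B)"
proof -
  have 1: "det (gmean A B) * det (matrix_inv A) * det (gmean A B) = det B"
    using gmean(2)[OF A B] by (metis det_mul)
  have "det A * det (matrix_inv A) = 1"
    using A by (metis det_I det_mul matrix_inv_right pos_def_invertible)
  moreover have "det A * det B = (det A * det (matrix_inv A)) * (det (gmean A B))\<^sup>2"
    by (simp add: power2_eq_square mult_ac flip: 1)
  ultimately have "det A * det B = (det (gmean A B))\<^sup>2"
    by simp
  then show ?thesis
    using det_pos_def[OF gmean(1)[OF A B]] by simp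
qed

text \<open>If \<open>R\<close> is a witness for \<open>B\<close> and \<open>C\<close>, then
  \<open>gmean A R\<close> is one for the means. Its determinant is
  \<open>sqrt (det A * det R)\<close>, so \<open>det A\<close> cancels in the ratio and the root of
  the old ratio remains.\<close>

lemma expansion_le_gmean:
  fixes A B C :: "real^'n^'n"
  assumes A: "A \<in> pos_def_matrices" and B: "B \<in> pos_def_matrices" and C: "C \<in> pos_def_matrices"
    and le: "expansion_le B C c"
  shows "expansion_le (gmean A B) (gmean A C) (sqrt c)"
proof -
  obtain R where R: "transpose R = R" "B \<preceq> R" "C \<preceq> R" "det R \<le> c * det B"
    using le unfolding expansion_le_def by blast
  have Rpd: "R \<in> pos_def_matrices"
    using pos_def_mono B R by blast
  have "det A * det R \<le> det A * (c * det B)"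
    using R det_pos_def[OF A] by simp
  then have "det (gmean A R) \<le> sqrt c * det (gmean A B)"
    using A B Rpd by (simp add: det_gmean algebra_simps flip: real_sqrt_mult)
  moreover have "transpose (gmean A R) = gmean A R"
    using gmean(1)[OF A Rpd] by (simp add: pos_def_quad)
  ultimately show ?thesis
    unfolding expansion_le_def using A B C Rpd R gmean_mono_right by blast
qed

section \<open>Continuity of the geometric mean and stability of expansion bounds\<close>

lemma pos_def_lower_bound:
  fixes A :: "real^'n^'n"
  assumes A: "A \<in> pos_def_matrices"
  shows "\<exists>m>0. \<forall>v. m * (norm v)\<^sup>2 \<le> quad A v"
proof -
  have "transpose A = A"
    using A by (simp add: pos_def_quad)
  then obtain S :: "real^'n^'n" where S: "invertible S" and SA: "transpose S ** A ** S = mat 1"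
    using simultaneous_diagonalization[OF A] by blast
  define k where "k = onorm ((*v) S) + 1"
  have k: "k > 0"
    unfolding k_def using onorm_pos_le[of "(*v) S"] by simp
  have "1 / k\<^sup>2 * (norm v)\<^sup>2 \<le> quad A v" for v
  proof -
    define w where "w = matrix_inv S *v v"
    have v: "v = S *v w"
      using S by (simp add: w_def matrix_vector_mul_assoc matrix_inv_right)
    have "quad A v = (norm w)\<^sup>2"
      using quad_congruence[of S A w] by (simp add: SA quad_mat_1 flip: v)
    moreover have "norm (S *v w) \<le> onorm ((*v) S) * norm w"
      by (simp add: onorm)
    then have "norm v \<le> k * norm w"
      unfolding k_def distrib_right v[symmetric] by (simp add: add_increasing2)
    then have "(norm v)\<^sup>2 \<le> k\<^sup>2 * (norm w)\<^sup>2"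
      by (metis norm_ge_zero power_mono power_mult_distrib)
    ultimately show ?thesis
      using k by (simp add: field_simps)
  qed
  then show ?thesis
    using k by (intro exI[of _ "1 / k\<^sup>2"]) auto
qed

lemma abs_quad_le:
  fixes D :: "real^'n^'n"
  shows "\<bar>quad D v\<bar> \<le> real CARD('n) * real CARD('n) * norm D * (norm v)\<^sup>2"
proof -
  have "\<bar>D $ i $ j\<bar> \<le> norm D" for i j
    by (meson component_le_norm_cart Finite_Cartesian_Product.norm_nth_le order_trans)
  then have on: "onorm ((*v) D) \<le> real CARD('n) * real CARD('n) * norm D"
    by (rule onorm_le_matrix_component)
  have "\<bar>quad D v\<bar> \<le> norm (D *v v) * norm v"
    unfolding quad_def by (rule Cauchy_Schwarz_ineq2)
  also have "\<dots> \<le> (onorm ((*v) D) * norm v) * norm v"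
    by (intro mult_right_mono onorm) auto
  also have "\<dots> \<le> (real CARD('n) * real CARD('n) * norm D * norm v) * norm v"
    using on by (intro mult_right_mono) auto
  finally show ?thesis
    by (simp add: power2_eq_square mult.assoc)
qed

text \<open>The error is measured by a positive definite form instead of the norm. Taking
  \<open>R = H\<close> turns convergence into a Loewner sandwich between multiples of the
  limit.\<close>

lemma eventually_quad_close:
  fixes H R :: "real^'n^'n"
  assumes R: "R \<in> pos_def_matrices" and e: "0 < e" and h: "(h \<longlongrightarrow> H) F"
  shows "\<forall>\<^sub>F x in F. \<forall>v. \<bar>quad (h x) v - quad H v\<bar> \<le> e * quad R v"
proof -
  obtain m where m: "m > 0" "\<And>v. m * (norm v)\<^sup>2 \<le> quad R v"
    using pos_def_lower_bound[OF R] by blast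
  define N where "N = real CARD('n) * real CARD('n)"
  have N: "N > 0"
    by (simp add: N_def)
  have "\<forall>\<^sub>F x in F. dist (h x) H < e * m / N"
    using h e m N by (intro tendstoD) auto
  then show ?thesis
  proof eventually_elim
    case (elim x)
    show ?case
    proof
      fix v
      have "\<bar>quad (h x) v - quad H v\<bar> \<le> N * norm (h x - H) * (norm v)\<^sup>2"
        using abs_quad_le[of "h x - H" v] by (simp add: quad_diff N_def)
      also have "\<dots> \<le> (e * m) * (norm v)\<^sup>2"
        using elim N by (intro mult_right_mono) (auto simp: dist_norm field_simps)
      also have "\<dots> \<le> e * quad R v"
        using m(2)[of v] e by (simp add: mult.assoc)
      finally show "\<bar>quad (h x) v - quad H v\<bar> \<le> e * quad R v" .
    qed
  qed
qed

lemma tendsto_symmetric_matrixI: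
  fixes X :: "real^'n^'n"
  assumes sym: "transpose X = X" "\<forall>\<^sub>F x in F. transpose (h x) = h x"
    and q: "\<And>v. ((\<lambda>x. quad (h x) v) \<longlongrightarrow> quad X v) F"
  shows "(h \<longlongrightarrow> X) F"
proof (intro vec_tendstoI)
  fix i j
  have entry: "M $ j $ i = (quad M (axis i 1 + axis j 1) - quad M (axis i 1) - quad M (axis j 1)) / 2"
    if "transpose M = M" for M :: "real^'n^'n"
    using polarization[OF that, of "axis i 1" "axis j 1"]
    by (simp add: matrix_vector_mult_basis inner_axis column_def)
  have "((\<lambda>x. (quad (h x) (axis i 1 + axis j 1) - quad (h x) (axis i 1) - quad (h x) (axis j 1)) / 2)
      \<longlongrightarrow> X $ j $ i) F"
    unfolding entry[OF sym(1)] by (intro tendsto_intros q) auto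
  then show "((\<lambda>x. h x $ j $ i) \<longlongrightarrow> X $ j $ i) F"
    by (rule Lim_transform_eventually) (use sym(2) in \<open>eventually_elim, simp add: entry\<close>)
qed

text \<open>Continuity comes from monotonicity and homogeneity: once \<open>f x\<close> and
  \<open>g x\<close> lie between \<open>1 - r\<close> and \<open>1 + r\<close> times
  \<open>A\<close> and \<open>B\<close>, their mean lies between the same multiples of
  \<open>gmean A B\<close>.\<close>

lemma tendsto_gmean:
  fixes A B :: "real^'n^'n"
  assumes A: "A \<in> pos_def_matrices" and B: "B \<in> pos_def_matrices"
    and f: "(f \<longlongrightarrow> A) F" "\<forall>\<^sub>F x in F. f x \<in> pos_def_matrices"
    and g: "(g \<longlongrightarrow> B) F" "\<forall>\<^sub>F x in F. g x \<in> pos_def_matrices"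
  shows "((\<lambda>x. gmean (f x) (g x)) \<longlongrightarrow> gmean A B) F"
proof (rule tendsto_symmetric_matrixI)
  define X where "X = gmean A B"
  have X: "X \<in> pos_def_matrices"
    using gmean A B by (simp add: X_def)
  show "transpose (gmean A B) = gmean A B"
    using gmean(1)[OF A B] by (simp add: pos_def_quad)
  show "\<forall>\<^sub>F x in F. transpose (gmean (f x) (g x)) = gmean (f x) (g x)"
    using f(2) g(2) by eventually_elim (metis gmean(1) pos_def_quad)
  fix v
  show "((\<lambda>x. quad (gmean (f x) (g x)) v) \<longlongrightarrow> quad (gmean A B) v) F"
  proof (rule tendstoI)
    fix e :: real assume e: "e > 0"
    have qX: "quad X v \<ge> 0"
      using pos_def_nonneg[OF X] by (simp add: loewner_le_def quad_def[of 0])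
    \<comment> \<open>The first bound keeps \<open>1 - r\<close> positive, so the scaled matrices
      stay positive definite; the second makes \<open>r * quad X v\<close> smaller than
      \<open>e\<close>.\<close>
    define r where "r = min (1/2) (e / (2 * (quad X v + 1)))"
    have r: "0 < r" "r < 1"
      unfolding r_def using e qX by auto
    have "r * quad X v \<le> e / (2 * (quad X v + 1)) * quad X v"
      unfolding r_def using qX by (intro mult_right_mono) auto
    also have "\<dots> < e"
      using e qX by (simp add: field_simps add_nonneg_pos add_pos_nonneg)
    finally have re: "r * quad X v < e" .
    have "\<forall>\<^sub>F x in F. \<forall>v. \<bar>quad (f x) v - quad A v\<bar> \<le> r * quad A v"
      "\<forall>\<^sub>F x in F. \<forall>v. \<bar>quad (g x) v - quad B v\<bar> \<le> r * quad B v"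
      using eventually_quad_close r f g A B by blast+
    with f(2) g(2) show "\<forall>\<^sub>F x in F. dist (quad (gmean (f x) (g x)) v) (quad (gmean A B) v) < e"
    proof eventually_elim
      case (elim x)
      have "(1 - r) *\<^sub>R A \<preceq> f x" "f x \<preceq> (1 + r) *\<^sub>R A" "(1 - r) *\<^sub>R B \<preceq> g x" "g x \<preceq> (1 + r) *\<^sub>R B"
        using elim(3,4) unfolding loewner_le_def quad_scaleR by (auto simp: abs_le_iff algebra_simps)
      then have "gmean ((1 - r) *\<^sub>R A) ((1 - r) *\<^sub>R B) \<preceq> gmean (f x) (g x)"
        "gmean (f x) (g x) \<preceq> gmean ((1 + r) *\<^sub>R A) ((1 + r) *\<^sub>R B)"
        using elim A B r by (auto intro!: gmean_mono pos_def_scaleR)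
      then have "(1 - r) * quad X v \<le> quad (gmean (f x) (g x)) v" "quad (gmean (f x) (g x)) v \<le> (1 + r) * quad X v"
        using A B r by (simp_all add: gmean_scaleR loewner_le_def quad_scaleR X_def)
      then show ?case
        using re by (simp add: dist_real_def X_def[symmetric] abs_less_iff algebra_simps)
    qed
  qed
qed

lemma tendsto_det:
  fixes h :: "_ \<Rightarrow> real^'n^'n"
  shows "(h \<longlongrightarrow> H) F \<Longrightarrow> ((\<lambda>x. det (h x)) \<longlongrightarrow> det H) F"
  unfolding det_def by (intro tendsto_intros)

lemma det_scaleR: "det (c *\<^sub>R A) = c ^ CARD('n) * det A" for A :: "real^'n^'n"
proof -
  have "c *\<^sub>R A = matrix ((*\<^sub>R) c) ** A"
    by (simp add: matrix_eq matrix_scaleR mat_vector_mult flip: matrix_vector_mul_assoc scaleR_matrix_vector_assoc)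
  then show ?thesis
    by (simp only: det_mul det_matrix_scaleR)
qed

text \<open>An enlarged witness \<open>(1 + e) *\<^sub>R R\<close> serves all nearby pairs; the gap
  between \<open>c\<close> and \<open>c'\<close> pays for the factor
  \<open>(1 + e) ^ CARD('n)\<close> and for the variation of \<open>det (f x)\<close>. This is upper
  semicontinuity of the least expansion constant.\<close>

lemma eventually_expansion_le:
  fixes P Q :: "real^'n^'n"
  assumes P: "P \<in> pos_def_matrices" and le: "expansion_le P Q c" and c: "c < c'"
    and f: "(f \<longlongrightarrow> P) F" and g: "(g \<longlongrightarrow> Q) F"
  shows "\<forall>\<^sub>F x in F. expansion_le (f x) (g x) c'"
proof -
  obtain R where R: "transpose R = R" "P \<preceq> R" "Q \<preceq> R" "det R \<le> c * det P"
    using le unfolding expansion_le_def by blast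
  have Rpd: "R \<in> pos_def_matrices"
    using pos_def_mono P R by blast
  have "((\<lambda>e. (1 + e) ^ CARD('n) * det R) \<longlongrightarrow> (1 + 0) ^ CARD('n) * det R) (at_right (0::real))"
    by (intro tendsto_intros)
  moreover have "(1 + 0) ^ CARD('n) * det R < c' * det P"
    using R(4) c det_pos_def[OF P] by (simp add: le_less_trans)
  ultimately have "\<forall>\<^sub>F e in at_right (0::real). (1 + e) ^ CARD('n) * det R < c' * det P"
    by (rule order_tendstoD)
  then have "\<forall>\<^sub>F e in at_right (0::real). (1 + e) ^ CARD('n) * det R < c' * det P \<and> e > 0"
    by (simp add: eventually_at_right_less eventually_conj)
  then obtain e where e: "(1 + e) ^ CARD('n) * det R < c' * det P" "e > 0"
    using eventually_happens trivial_limit_at_right_real by blast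
  have "((\<lambda>x. c' * det (f x)) \<longlongrightarrow> c' * det P) F"
    by (intro tendsto_intros tendsto_det f)
  then have "\<forall>\<^sub>F x in F. (1 + e) ^ CARD('n) * det R < c' * det (f x)"
    using e(1) by (rule order_tendstoD)
  moreover note eventually_quad_close[OF Rpd e(2) f] eventually_quad_close[OF Rpd e(2) g]
  ultimately show ?thesis
  proof eventually_elim
    case (elim x)
    have le: "M' \<preceq> (1 + e) *\<^sub>R R" if "\<forall>v. \<bar>quad M' v - quad M v\<bar> \<le> e * quad R v" "M \<preceq> R" for M M'
      unfolding loewner_le_def quad_scaleR
    proof
      fix v show "quad M' v \<le> (1 + e) * quad R v"
        using that(1)[rule_format, of v] that(2)[unfolded loewner_le_def, rule_format, of v]
        by (simp add: algebra_simps abs_le_iff)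
    qed
    show ?case
      unfolding expansion_le_def
      using le[OF elim(2) R(2)] le[OF elim(3) R(3)] elim(1) R(1)
      by (intro exI[of _ "(1 + e) *\<^sub>R R"]) (simp add: transpose_scalar det_scaleR)
  qed
qed

subsection \<open>Linearization and ball coverings\<close>

lemma C1_has_derivative: "C1_map f \<Longrightarrow> (f has_derivative (\<lambda>h. jacobian f (at x) *v h)) (at x)"
  by (simp add: C1_map_def flip: jacobian_works)

lemma jacobian_eqI:
  fixes f :: "real^'n \<Rightarrow> real^'n"
  assumes "(f has_derivative (\<lambda>h. A *v h)) (at x)"
  shows "jacobian f (at x) = A"
  unfolding jacobian_def using frechet_derivative_at[OF assms] by (metis matrix_of_matrix_vector_mul)

lemma tendsto_matrix_mult:
  fixes f g :: "_ \<Rightarrow> real^'n^'n"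
  assumes "(f \<longlongrightarrow> A) F" "(g \<longlongrightarrow> B) F"
  shows "((\<lambda>x. f x ** g x) \<longlongrightarrow> A ** B) F"
  unfolding matrix_matrix_mult_def by (intro tendsto_intros assms)

lemma tendsto_transpose:
  fixes f :: "_ \<Rightarrow> real^'n^'m"
  assumes "(f \<longlongrightarrow> A) F"
  shows "((\<lambda>x. transpose (f x)) \<longlongrightarrow> transpose A) F"
  unfolding transpose_def by (intro tendsto_intros assms)

lemma continuous_on_matrix_mult:
  fixes f g :: "_ \<Rightarrow> real^'n^'n"
  shows "continuous_on S f \<Longrightarrow> continuous_on S g \<Longrightarrow> continuous_on S (\<lambda>x. f x ** g x)"
  unfolding continuous_on_def by (intro ballI tendsto_matrix_mult) auto

lemma continuous_on_transpose:
  fixes f :: "_ \<Rightarrow> real^'n^'m"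
  shows "continuous_on S f \<Longrightarrow> continuous_on S (\<lambda>x. transpose (f x))"
  unfolding continuous_on_def by (intro ballI tendsto_transpose) auto

lemma continuous_on_det:
  fixes f :: "_ \<Rightarrow> real^'n^'n"
  shows "continuous_on S f \<Longrightarrow> continuous_on S (\<lambda>x. det (f x))"
  unfolding continuous_on_def by (intro ballI tendsto_det) auto

lemma C1_continuous_on: "C1_map f \<Longrightarrow> continuous_on S f"
  by (meson C1_map_def continuous_at_imp_continuous_on differentiable_imp_continuous_within)

lemma jacobian_compose:
  assumes "C1_map f" "C1_map g"
  shows "jacobian (f \<circ> g) (at x) = jacobian f (at (g x)) ** jacobian g (at x)"
proof (rule jacobian_eqI)
  have "((f \<circ> g) has_derivative (\<lambda>h. jacobian f (at (g x)) *v h) \<circ> (\<lambda>h. jacobian g (at x) *v h)) (at x)"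
    using assms by (intro diff_chain_at C1_has_derivative)
  then show "((f \<circ> g) has_derivative (\<lambda>h. (jacobian f (at (g x)) ** jacobian g (at x)) *v h)) (at x)"
    by (simp add: comp_def matrix_vector_mul_assoc)
qed

lemma C1_compose:
  assumes f: "C1_map f" and g: "C1_map g"
  shows "C1_map (f \<circ> g)"
proof -
  have "continuous_on UNIV (\<lambda>x. jacobian f (at (g x)))"
    using f C1_continuous_on[OF g] unfolding C1_map_def by (auto intro: continuous_on_compose2)
  then have "continuous_on UNIV (\<lambda>x. jacobian (f \<circ> g) (at x))"
    using g unfolding jacobian_compose[OF f g] C1_map_def by (auto intro: continuous_on_matrix_mult)
  moreover have "(f \<circ> g) differentiable (at x)" for x
    using f g unfolding C1_map_def by (intro differentiable_chain_at) auto
  ultimately show ?thesis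
    by (simp add: C1_map_def)
qed

lemma jacobian_id: "jacobian (id :: real^'n \<Rightarrow> real^'n) (at x) = mat 1"
  by (rule jacobian_eqI) (simp add: id_def)

lemma C1_funpow:
  fixes f :: "real^'n \<Rightarrow> real^'n"
  shows "C1_map f \<Longrightarrow> C1_map (f ^^ t)"
proof (induction t)
  case 0
  have "C1_map (id :: real^'n \<Rightarrow> real^'n)"
    unfolding C1_map_def jacobian_id by (auto simp: id_def continuous_on_const)
  then show ?case by (simp add: id_def)
next
  case (Suc t)
  then have "C1_map (f \<circ> f ^^ t)"
    by (intro C1_compose) auto
  then show ?case by (simp add: comp_def)
qed

lemma jacobian_funpow_add:
  assumes "C1_map f"
  shows "jacobian (f ^^ (s + t)) (at x) = jacobian (f ^^ s) (at ((f ^^ t) x)) ** jacobian (f ^^ t) (at x)"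
  using jacobian_compose[OF C1_funpow C1_funpow, OF assms assms] by (simp add: funpow_add)

text \<open>The segments from \<open>a\<close> to \<open>x\<close> may leave \<open>K\<close>, so
  uniform continuity of the Jacobian is taken on the closed unit neighbourhood \<open>K1\<close>
  before the mean value inequality is applied.\<close>

lemma uniform_linearization:
  fixes f :: "real^'n \<Rightarrow> real^'n"
  assumes f: "C1_map f" and K: "compact K" and e: "0 < e"
  shows "\<exists>d>0. \<forall>a\<in>K. \<forall>x. norm (x - a) < d \<longrightarrow>
    norm (f x - f a - jacobian f (at a) *v (x - a)) \<le> e * norm (x - a)"
proof -
  define J where "J x = jacobian f (at x)" for x
  define K1 where "K1 = {x + y | x y. x \<in> K \<and> y \<in> cball 0 1}"
  have "compact K1"
    unfolding K1_def using K by (intro compact_sums) auto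
  moreover have "continuous_on K1 J"
    using f continuous_on_subset unfolding C1_map_def J_def by blast
  ultimately have unif: "uniformly_continuous_on K1 J"
    by (rule compact_uniformly_continuous[rotated])
  \<comment> \<open>The loss in passing from a bound on matrix entries to one on the operator
    norm.\<close>
  define N where "N = real CARD('n) * real CARD('n)"
  have N: "N > 0"
    by (simp add: N_def)
  obtain d where d: "d > 0" "\<And>x y. x \<in> K1 \<Longrightarrow> y \<in> K1 \<Longrightarrow> dist y x < d \<Longrightarrow> dist (J y) (J x) < e / N"
    using unif[unfolded uniformly_continuous_on_def, rule_format, of "e / N"] e N by auto
  have "norm (f x - f a - J a *v (x - a)) \<le> e * norm (x - a)"
    if a: "a \<in> K" and x: "norm (x - a) < min d 1" for a x
  proof -
    define S where "S = ball a (min d 1)"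
    have S: "y \<in> K1 \<and> dist y a < d" if "y \<in> S" for y
    proof -
      have "y = a + (y - a)" "norm (y - a) \<le> 1"
        using that by (auto simp: S_def dist_norm norm_minus_commute)
      then show ?thesis
        using that a unfolding K1_def by (fastforce simp: S_def dist_commute mem_cball_0)
    qed
    have aS: "a \<in> S"
      using d by (simp add: S_def)
    have "norm (f x - f a - J a *v (x - a)) \<le> norm (x - a) * e"
    proof (rule differentiable_bound_linearization[where S = S and f' = "\<lambda>y h. J y *v h"])
      show "a + t *\<^sub>R (x - a) \<in> S" if "t \<in> {0..1}" for t
      proof -
        have "norm (t *\<^sub>R (x - a)) \<le> norm (x - a)"
          using that by (simp add: mult_left_le_one_le)
        then show ?thesis
          using x by (simp add: S_def dist_norm)
      qed
      show "(f has_derivative (\<lambda>h. J y *v h)) (at y within S)" if "y \<in> S" for y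
        unfolding J_def by (rule has_derivative_at_withinI[OF C1_has_derivative[OF f]])
      show "onorm ((*v) (J y) - (*v) (J a)) \<le> e" if "y \<in> S" for y
      proof -
        have "(*v) (J y) - (*v) (J a) = (*v) (J y - J a)"
          by (simp add: fun_eq_iff matrix_vector_mult_diff_rdistrib)
        moreover have "norm (J y - J a) \<le> e / N"
          using d(2)[of a y] S[OF that] S[OF aS] by (simp add: dist_norm less_imp_le)
        then have "\<bar>(J y - J a) $ i $ j\<bar> \<le> e / N" for i j
          by (meson component_le_norm_cart Finite_Cartesian_Product.norm_nth_le order_trans)
        then have "onorm ((*v) (J y - J a)) \<le> N * (e / N)"
          unfolding N_def by (rule onorm_le_matrix_component)
        ultimately show ?thesis
          using N by simp
      qed
    qed (rule aS)
    then show ?thesis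
      by (simp add: mult.commute)
  qed
  then show ?thesis
    using d(1) unfolding J_def by (intro exI[of _ "min d 1"]) auto
qed

section \<open>Volume bounds for coverings by balls\<close>

lemma norm_orthogonal_matrix: "orthogonal_matrix W \<Longrightarrow> norm (W *v x) = norm x" for W :: "real^'n^'n"
  using quad_transpose_mult[of W x] by (simp add: orthogonal_matrix quad_mat_1)

lemma measure_diag_ball:
  fixes b :: "real^'n"
  assumes "0 \<le> r" "\<And>i. 0 < s i"
  shows "(\<lambda>u. b + diag s *v u) ` ball 0 r \<in> lmeasurable"
    and "measure lebesgue ((\<lambda>u. b + diag s *v u) ` ball 0 r)
      = (\<Prod>i\<in>UNIV. s i) * r ^ CARD('n) * measure lebesgue (ball (0::real^'n) 1)"
proof -
  have "diag s *v u = (\<chi> i. s i * u $ i)" for u :: "real^'n"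
    by (simp add: vec_eq_iff diag_vector_component)
  then have eq: "(\<lambda>u. b + diag s *v u) ` ball 0 r = (+) b ` (\<lambda>u. \<chi> i. s i * u $ i) ` ball 0 r"
    by (simp add: image_image)
  show "(\<lambda>u. b + diag s *v u) ` ball 0 r \<in> lmeasurable"
    unfolding eq by (intro measurable_translation measurable_stretch lmeasurable_ball)
  have "measure lebesgue ((\<lambda>u. b + diag s *v u) ` ball 0 r)
      = \<bar>\<Prod>i\<in>UNIV. s i\<bar> * measure lebesgue (ball (0::real^'n) r)"
    unfolding eq measure_translation using measure_stretch[OF lmeasurable_ball, of s 0 r] by simp
  also have "measure lebesgue (ball (0::real^'n) r) = r ^ CARD('n) * measure lebesgue (ball (0::real^'n) 1)"
    using content_ball_conv_unit_ball[OF assms(1), of "0::real^'n"] by simp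
  also have "\<bar>\<Prod>i\<in>UNIV. s i\<bar> = (\<Prod>i\<in>UNIV. s i)"
    using assms by (simp add: prod_pos less_imp_le)
  finally show "measure lebesgue ((\<lambda>u. b + diag s *v u) ` ball 0 r)
      = (\<Prod>i\<in>UNIV. s i) * r ^ CARD('n) * measure lebesgue (ball (0::real^'n) 1)"
    by simp
qed

lemma measure_ball_cart:
  fixes c :: "real^'n"
  assumes "0 \<le> r"
  shows "measure lebesgue (ball c r) = r ^ CARD('n) * measure lebesgue (ball (0::real^'n) 1)"
  using content_ball_conv_unit_ball[OF assms, of c] by simp

lemma measure_unit_ball_pos: "measure lebesgue (ball (0::real^'n) 1) > 0"
  using content_ball_pos[of 1 "0::real^'n"] by simp

text \<open>A largest \<open>d\<close>-separated subset of \<open>Y\<close> covers \<open>Y\<close>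
  by balls of radius \<open>d\<close>, while the balls of half that radius are disjoint inside
  \<open>Z\<close>, so volume limits their number. That the centres lie in \<open>Y\<close> is used
  for recentring in \<open>K\<close>.\<close>

lemma cover_by_packing:
  fixes Y :: "(real^'n) set"
  assumes d: "0 < d" and Z: "Z \<in> lmeasurable" and sub: "(\<Union>y\<in>Y. ball y (d / 2)) \<subseteq> Z"
    and meas: "measure lebesgue Z \<le> m * ((d / 2) ^ CARD('n) * measure lebesgue (ball (0::real^'n) 1))"
  shows "\<exists>C\<subseteq>Y. finite C \<and> real (card C) \<le> m \<and> Y \<subseteq> (\<Union>c\<in>C. ball c d)"
proof -
  define sep where "sep F \<longleftrightarrow> finite F \<and> F \<subseteq> Y \<and> pairwise (\<lambda>x y. d \<le> dist x y) F" for F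
  let ?u = "(d / 2) ^ CARD('n) * measure lebesgue (ball (0::real^'n) 1)"
  have u: "?u > 0"
    using d measure_unit_ball_pos by simp
  have card: "real (card F) \<le> m" if F: "sep F" for F
  proof -
    have "disjoint_family_on (\<lambda>y. ball y (d / 2)) F"
      unfolding disjoint_family_on_def
    proof (intro ballI impI)
      fix x y assume "x \<in> F" "y \<in> F" "x \<noteq> y"
      then have "d \<le> dist x y"
        using F by (auto simp: sep_def pairwise_def)
      then show "ball x (d / 2) \<inter> ball y (d / 2) = {}"
        by (intro disjoint_ballI) simp
    qed
    then have "measure lebesgue (\<Union>y\<in>F. ball y (d / 2)) = (\<Sum>y\<in>F. measure lebesgue (ball y (d / 2)))"
      using F by (intro measure_finite_Union) (auto simp: sep_def emeasure_lborel_ball_finite[THEN less_imp_neq, simplified])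
    also have "\<dots> = real (card F) * ?u"
      using d by (subst measure_ball_cart) auto
    finally have "real (card F) * ?u = measure lebesgue (\<Union>y\<in>F. ball y (d / 2))" ..
    also have "\<dots> \<le> measure lebesgue Z"
      using F sub Z by (intro measure_mono_fmeasurable) (auto simp: sep_def)
    also have "\<dots> \<le> m * ?u"
      by (rule meas)
    finally show ?thesis
      using u by (simp only: mult_le_cancel_right_pos)
  qed
  have "sep {}"
    by (simp add: sep_def)
  moreover have "card F < Suc (nat \<lfloor>m\<rfloor>)" if "sep F" for F
    using card[OF that] by (simp add: less_Suc_eq_le le_nat_floor)
  ultimately obtain C where C: "sep C" and Cmax: "\<And>F. sep F \<Longrightarrow> card F \<le> card C"
    using ex_has_greatest_nat[of sep "{}" card] by blast
  have "Y \<subseteq> (\<Union>c\<in>C. ball c d)"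
  proof
    fix y assume y: "y \<in> Y"
    show "y \<in> (\<Union>c\<in>C. ball c d)"
    proof (rule ccontr)
      assume "y \<notin> (\<Union>c\<in>C. ball c d)"
      then have far: "\<And>c. c \<in> C \<Longrightarrow> d \<le> dist c y"
        by (auto simp: not_less)
      then have "y \<notin> C"
        using d by fastforce
      moreover have "sep (insert y C)"
        using C y far by (auto simp: sep_def pairwise_insert dist_commute)
      ultimately show False
        using Cmax[of "insert y C"] C by (simp add: sep_def)
    qed
  qed
  then show ?thesis
    using C card[OF C] by (auto simp: sep_def)
qed

lemma ball_cover_card_ge:
  fixes b :: "real^'n"
  assumes "finite C" "0 \<le> r" "0 \<le> R" "\<And>i. 0 < s i"
    and sub: "(\<lambda>u. b + diag s *v u) ` ball 0 r \<subseteq> (\<Union>c\<in>C. ball c R)"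
  shows "(\<Prod>i\<in>UNIV. s i) * r ^ CARD('n) \<le> real (card C) * R ^ CARD('n)"
proof -
  note ell = measure_diag_ball[OF assms(2,4), of b]
  have "(\<Prod>i\<in>UNIV. s i) * r ^ CARD('n) * measure lebesgue (ball (0::real^'n) 1)
      \<le> measure lebesgue (\<Union>c\<in>C. ball c R)"
    using assms(1) unfolding ell(2)[symmetric]
    by (intro measure_mono_fmeasurable[OF sub] fmeasurableD[OF ell(1)] fmeasurable.finite_UN) auto
  also have "\<dots> \<le> (\<Sum>c\<in>C. measure lebesgue (ball c R))"
    using assms by (intro measure_UNION_le) auto
  also have "\<dots> = (real (card C) * R ^ CARD('n)) * measure lebesgue (ball (0::real^'n) 1)"
    by (simp only: measure_ball_cart[OF assms(3)] sum_constant mult.assoc)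
  finally show ?thesis
    using measure_unit_ball_pos[where 'n='n] by (simp only: mult_le_cancel_right_pos)
qed

text \<open>Its determinant is the product of \<open>1 + \<sigma>\<^sup>2\<close> over the ordinary
  singular values \<open>\<sigma>\<close> of \<open>L\<close>, hence equal to the product of
  \<open>max 1 (\<sigma>\<^sup>2)\<close> up to a factor between 1 and \<open>2 ^ CARD('n)\<close>.
  Its root maps the unit ball to an ellipsoid comparable with the sum of \<open>L\<close> applied to
  the unit ball and the unit ball itself.\<close>

definition gram :: "real^'n^'n \<Rightarrow> real^'n^'n" where
  "gram L = mat 1 + L ** transpose L"

lemma quad_gram: "quad (gram L) v = (norm v)\<^sup>2 + (norm (transpose L *v v))\<^sup>2"
  using quad_transpose_mult[of "transpose L" v] by (simp add: gram_def quad_add quad_mat_1)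

lemma transpose_gram: "transpose (gram L) = gram L"
  by (simp add: gram_def transpose_add matrix_transpose_mul)

lemma pos_def_gram: "gram L \<in> pos_def_matrices"
  by (rule pos_def_mono[OF pos_def_mat_1]) (auto simp: transpose_gram loewner_le_def quad_gram quad_mat_1)

lemma det_gram_transpose: "det (gram L) = det (mat 1 + transpose L ** L)"
  unfolding gram_def by (rule sylvester_det)

text \<open>In the coordinates given by \<open>W\<close>, \<open>diag s\<close> is the square root of \<open>gram L\<close>. Only diagonal maps are
  needed in the volume estimates: the library's formula for the measure of a general linear image
  requires a well-ordered index type.\<close>

lemma gram_root:
  fixes L :: "real^'n^'n"
  obtains W :: "real^'n^'n" and s where "orthogonal_matrix W" "\<forall>i. 0 < s i"
    "(\<Prod>i\<in>UNIV. s i) = sqrt (det (gram L))"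
    "\<forall>v w. \<exists>u. W *v (L *v v + w) = diag s *v u \<and> norm u \<le> norm v + norm w"
    "\<forall>u. \<exists>v w. diag s *v u = W *v (L *v v + w) \<and> norm v \<le> norm u \<and> norm w \<le> norm u"
proof -
  obtain T where T: "T \<in> pos_def_matrices" "T ** T = gram L"
    using pos_def_sqrt[OF pos_def_gram] by blast
  have inv: "invertible T" and sym: "transpose T = T"
    using T pos_def_invertible by (auto simp: pos_def_quad)
  define S where "S = matrix_inv T"
  have ST: "S *v (T *v x) = x" "T *v (S *v x) = x" for x
    using inv by (simp_all add: S_def matrix_vector_mul_assoc matrix_inv_left matrix_inv_right)
  have Ssym: "transpose S = S"
    unfolding S_def using inv sym by (metis matrix_inv_transpose)
  have normT: "(norm (T *v x))\<^sup>2 = (norm x)\<^sup>2 + (norm (transpose L *v x))\<^sup>2" for x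
    using quad_transpose_mult[of T x] by (simp add: sym T quad_gram)
  have le1: "norm x \<le> norm (T *v x)" and le2: "norm (transpose L *v x) \<le> norm (T *v x)" for x
    using normT[of x] by (auto intro: power2_le_imp_le)
  \<comment> \<open>Since \<open>T\<close> dominates \<open>transpose L\<close> in norm,
    \<open>transpose L ** S\<close> is a contraction, and therefore so is its transpose
    \<open>S ** L\<close>; \<open>S\<close> itself is one by \<open>le1\<close>.\<close>
  have sum: "\<exists>u. L *v v + w = T *v u \<and> norm u \<le> norm v + norm w" for v w
  proof (intro exI conjI)
    show "L *v v + w = T *v (S *v (L *v v) + S *v w)"
      by (simp add: matrix_vector_right_distrib ST)
    define z where "z = S *v (L *v v)"
    have "norm z * norm z = z \<bullet> (S *v (L *v v))"
      by (simp add: z_def power2_norm_eq_inner flip: power2_eq_square)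
    also have "\<dots> = (transpose L *v (S *v z)) \<bullet> v"
      using inner_matrix_vector[of S z "L *v v"] inner_matrix_vector[of L v "S *v z"]
      by (simp add: Ssym inner_commute del: transpose_matrix_vector)
    also have "\<dots> \<le> norm (transpose L *v (S *v z)) * norm v"
      by (rule norm_cauchy_schwarz)
    also have "\<dots> \<le> norm z * norm v"
      using le2[of "S *v z"] by (intro mult_right_mono) (auto simp: ST)
    finally have "norm z \<le> norm v"
      by (cases "z = 0") auto
    moreover have "norm (S *v w) \<le> norm w"
      using le1[of "S *v w"] by (simp add: ST)
    ultimately show "norm (S *v (L *v v) + S *v w) \<le> norm v + norm w"
      unfolding z_def by (rule norm_triangle_mono)
  qed
  \<comment> \<open>With \<open>w = S *v u\<close>, the vector \<open>T *v u\<close> is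
    \<open>gram L *v w\<close>, whose two summands give the splitting.\<close>
  have split: "\<exists>v w. T *v u = L *v v + w \<and> norm v \<le> norm u \<and> norm w \<le> norm u" for u
  proof (intro exI conjI)
    define w where "w = S *v u"
    have "T *v u = gram L *v w"
      by (simp add: w_def ST flip: T(2) matrix_vector_mul_assoc)
    then show "T *v u = L *v (transpose L *v w) + w"
      by (simp add: gram_def matrix_vector_mult_add_rdistrib flip: matrix_vector_mul_assoc)
    show "norm (transpose L *v w) \<le> norm u" "norm w \<le> norm u"
      using le1[of w] le2[of w] by (simp_all add: w_def ST)
  qed
  obtain U s where U: "orthogonal_matrix U" and s: "transpose U ** T ** U = diag s"
    using spectral_theorem sym by metis
  define W where "W = transpose U"
  have W: "orthogonal_matrix W" and WU: "W ** U = mat 1" "U ** W = mat 1"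
    using U by (auto simp: W_def orthogonal_matrix_def)
  have normW: "norm (W *v x) = norm x" "norm (U *v x) = norm x" for x
    using U W by (simp_all add: norm_orthogonal_matrix)
  have WT: "W *v (T *v u) = diag s *v (W *v u)" for u
  proof -
    have "diag s ** W = W ** T ** (U ** W)"
      by (simp add: W_def matrix_mul_assoc flip: s)
    then show ?thesis
      by (simp add: WU matrix_vector_mul_assoc)
  qed
  show ?thesis
  proof (rule that[OF W])
    show "\<forall>i. 0 < s i"
      by (rule allI, rule congruence_eq_diag_entry[OF T(1) orthogonal_matrix_invertible[OF U] s])
    have "(det U)\<^sup>2 = 1"
      using det_orthogonal_matrix[OF U] by auto
    then have "(\<Prod>i\<in>UNIV. s i) = det T"
      using det_congruence[of U T] by (simp add: s det_diag)
    moreover have "det (gram L) = (det T)\<^sup>2"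
      using T(2) by (metis det_mul power2_eq_square)
    ultimately show "(\<Prod>i\<in>UNIV. s i) = sqrt (det (gram L))"
      using det_pos_def[OF T(1)] by simp
    show "\<forall>v w. \<exists>u. W *v (L *v v + w) = diag s *v u \<and> norm u \<le> norm v + norm w"
    proof (intro allI)
      fix v w
      obtain u where "L *v v + w = T *v u" "norm u \<le> norm v + norm w"
        using sum by blast
      then show "\<exists>u. W *v (L *v v + w) = diag s *v u \<and> norm u \<le> norm v + norm w"
        by (intro exI[of _ "W *v u"]) (simp only: WT normW simp_thms)
    qed
    show "\<forall>u. \<exists>v w. diag s *v u = W *v (L *v v + w) \<and> norm v \<le> norm u \<and> norm w \<le> norm u"
    proof
      fix u
      obtain v w where "T *v (U *v u) = L *v v + w" "norm v \<le> norm u" "norm w \<le> norm u"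
        using split[of "U *v u"] by (auto simp: normW)
      moreover have "diag s *v u = W *v (T *v (U *v u))"
        unfolding WT by (simp add: matrix_vector_mul_assoc WU flip: matrix_mul_assoc)
      ultimately show "\<exists>v w. diag s *v u = W *v (L *v v + w) \<and> norm v \<le> norm u \<and> norm w \<le> norm u"
        by auto
    qed
  qed
qed

text \<open>A point within \<open>d / 2\<close> of \<open>Y\<close> comes from some \<open>u\<close>
  of norm below \<open>d + d + d / 2 < 3 * d\<close>: the image of the ball, the error
  \<open>w\<close> and the packing radius. The ratio of \<open>3 * d\<close> to \<open>d / 2\<close>
  is the base 6.\<close>

lemma linear_image_cover:
  fixes L :: "real^'n^'n"
  assumes d: "0 < d"
    and Y: "\<And>y. y \<in> Y \<Longrightarrow> \<exists>v w. y = b + (L *v v + w) \<and> norm v < d \<and> norm w \<le> d"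
  shows "\<exists>C\<subseteq>Y. finite C \<and> real (card C) \<le> 6 ^ CARD('n) * sqrt (det (gram L)) \<and> Y \<subseteq> (\<Union>c\<in>C. ball c d)"
proof -
  obtain W :: "real^'n^'n" and s where W: "orthogonal_matrix W" and s: "\<forall>i. 0 < s i"
    "(\<Prod>i\<in>UNIV. s i) = sqrt (det (gram L))"
    and sum: "\<forall>v w. \<exists>u. W *v (L *v v + w) = diag s *v u \<and> norm u \<le> norm v + norm w"
    and "\<forall>u. \<exists>v w. diag s *v u = W *v (L *v v + w) \<and> norm v \<le> norm u \<and> norm w \<le> norm u"
    using gram_root[of L] by metis
  have norm: "norm (W *v x) = norm x" for x
    using W by (rule norm_orthogonal_matrix)
  then have dist: "dist (W *v x) (W *v y) = dist x y" for x y
    by (simp add: dist_norm flip: matrix_vector_mult_diff_distrib)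
  have onto: "\<exists>x. W *v x = y" for y
    using W by (metis matrix_vector_mul_assoc matrix_vector_mul_lid orthogonal_matrix_def)
  define Z where "Z = (\<lambda>u. W *v b + diag s *v u) ` ball 0 (3 * d)"
  have Z: "Z \<in> lmeasurable" "measure lebesgue Z
      = sqrt (det (gram L)) * (3 * d) ^ CARD('n) * measure lebesgue (ball (0::real^'n) 1)"
    unfolding Z_def using measure_diag_ball[of "3 * d" s "W *v b"] d s by auto
  have "(3 * d) ^ CARD('n) = 6 ^ CARD('n) * (d / 2) ^ CARD('n)"
    using power_mult_distrib[of 6 "d / 2" "CARD('n)"] by simp
  then have meas: "measure lebesgue Z \<le> (6 ^ CARD('n) * sqrt (det (gram L))) *
      ((d / 2) ^ CARD('n) * measure lebesgue (ball (0::real^'n) 1))"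
    unfolding Z(2) by (simp only: mult_ac order_refl)
  have "ball (W *v y) (d / 2) \<subseteq> Z" if y: "y \<in> Y" for y
  proof
    fix p assume p: "p \<in> ball (W *v y) (d / 2)"
    obtain q where q: "W *v q = p"
      using onto by blast
    then have yq: "norm (q - y) < d / 2"
      using p by (metis dist dist_commute dist_norm mem_ball)
    obtain v w where vw: "y = b + (L *v v + w)" "norm v < d" "norm w \<le> d"
      using Y[OF y] by blast
    obtain u where u: "W *v (L *v v + (w + (q - y))) = diag s *v u" "norm u \<le> norm v + norm (w + (q - y))"
      using sum by blast
    have "q = b + (L *v v + (w + (q - y)))"
      by (simp add: vw(1))
    then have "p = W *v b + diag s *v u"
      using q u(1) by (metis matrix_vector_right_distrib)
    moreover have "norm u < 3 * d"
      using u(2) vw yq norm_triangle_ineq[of w "q - y"] d by linarith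
    ultimately show "p \<in> Z"
      unfolding Z_def by auto
  qed
  then obtain C' where C': "C' \<subseteq> (*v) W ` Y" "finite C'" "real (card C') \<le> 6 ^ CARD('n) * sqrt (det (gram L))"
    "(*v) W ` Y \<subseteq> (\<Union>c\<in>C'. ball c d)"
    using cover_by_packing[OF d Z(1) _ meas, of "(*v) W ` Y"] by auto
  obtain C where C: "C \<subseteq> Y" "inj_on ((*v) W) C" "C' = (*v) W ` C"
    using C'(1) unfolding subset_image_inj by blast
  have "Y \<subseteq> (\<Union>c\<in>C. ball c d)"
  proof
    fix y assume "y \<in> Y"
    then obtain c where "c \<in> C" "W *v y \<in> ball (W *v c) d"
      using C'(4) unfolding C(3) by blast
    then show "y \<in> (\<Union>c\<in>C. ball c d)"
      by (auto simp: dist)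
  qed
  moreover have "finite C" "card C = card C'"
    using C C'(2) by (auto simp: card_image finite_image_iff)
  ultimately show ?thesis
    using C(1) C'(3) by (intro exI[of _ C]) simp
qed

text \<open>The second inclusion of \<open>gram_root\<close> places an ellipsoid of volume
  proportional to \<open>sqrt (det (gram L)) * r ^ CARD('n)\<close> inside the set to be
  covered.\<close>

lemma linear_image_cover_card_ge:
  fixes L :: "real^'n^'n"
  assumes C: "finite C" and r: "0 < r" and R: "0 \<le> R"
    and cover: "\<And>v w. norm v < r \<Longrightarrow> norm w < r \<Longrightarrow> b + (L *v v + w) \<in> (\<Union>c\<in>C. ball c R)"
  shows "sqrt (det (gram L)) * r ^ CARD('n) \<le> real (card C) * R ^ CARD('n)"
proof -
  obtain W :: "real^'n^'n" and s where W: "orthogonal_matrix W" and s: "\<forall>i. 0 < s i"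
    "(\<Prod>i\<in>UNIV. s i) = sqrt (det (gram L))"
    and "\<forall>v w. \<exists>u. W *v (L *v v + w) = diag s *v u \<and> norm u \<le> norm v + norm w"
    and split: "\<forall>u. \<exists>v w. diag s *v u = W *v (L *v v + w) \<and> norm v \<le> norm u \<and> norm w \<le> norm u"
    using gram_root[of L] by metis
  have norm: "norm (W *v x) = norm x" for x
    using W by (rule norm_orthogonal_matrix)
  then have dist: "dist (W *v x) (W *v y) = dist x y" for x y
    by (simp add: dist_norm flip: matrix_vector_mult_diff_distrib)
  have "(\<lambda>u. W *v b + diag s *v u) ` ball 0 r \<subseteq> (\<Union>c\<in>(*v) W ` C. ball c R)"
  proof clarify
    fix u :: "real^'n" assume "u \<in> ball 0 r"
    moreover obtain v w where vw: "diag s *v u = W *v (L *v v + w)" "norm v \<le> norm u" "norm w \<le> norm u"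
      using split by blast
    ultimately obtain c where c: "c \<in> C" "dist c (b + (L *v v + w)) < R"
      using cover[of v w] by auto
    have "W *v b + diag s *v u = W *v (b + (L *v v + w))"
      unfolding vw(1) by (simp only: matrix_vector_right_distrib)
    then show "W *v b + diag s *v u \<in> (\<Union>c\<in>(*v) W ` C. ball c R)"
      using c by (auto simp: dist)
  qed
  then have "(\<Prod>i\<in>UNIV. s i) * r ^ CARD('n) \<le> real (card ((*v) W ` C)) * R ^ CARD('n)"
    using C r R s by (intro ball_cover_card_ge) auto
  also have "\<dots> \<le> real (card C) * R ^ CARD('n)"
    using C R by (intro mult_right_mono) (auto simp: card_image_le)
  finally show ?thesis
    by (simp add: s)
qed

subsection \<open>Existence and estimates of the restoration entropy\<close>

text \<open>The defect \<open>c\<close> accounts for recentring balls: covering balls may have their centres outside \<open>K\<close>.\<close>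

lemma fekete_almost_subadditive:
  fixes r :: "nat \<Rightarrow> real"
  assumes add: "\<And>s t. r (s + t) \<le> r s + r t + c" and nonneg: "\<And>t. 0 \<le> r t"
  shows "convergent (\<lambda>t. r t / real t)"
proof -
  \<comment> \<open>Absorbing the defect once makes \<open>b\<close> subadditive; the added constant
    disappears after division by \<open>t\<close>.\<close>
  define b where "b t = r t + max c 0" for t
  have sub: "b (s + t) \<le> b s + b t" for s t
    using add[of s t] by (simp add: b_def max_def)
  have b0: "0 \<le> b t" for t
    using nonneg[of t] by (simp add: b_def)
  have mult: "b (q * m + i) \<le> real q * b m + b i" for q m i
  proof (induction q)
    case (Suc q)
    have "b (m + (q * m + i)) \<le> b m + b (q * m + i)"
      by (rule sub)
    then show ?case
      using Suc by (simp add: algebra_simps)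
  qed simp
  define L where "L = Inf ((\<lambda>t. b t / real t) ` {1..})"
  have bdd: "bdd_below ((\<lambda>t. b t / real t) ` {1..})"
    using b0 by (intro bdd_belowI[of _ 0]) auto
  have Lle: "L \<le> b t / real t" if "t \<ge> 1" for t
    unfolding L_def using that by (intro cInf_lower bdd) auto
  have "(\<lambda>t. b t / real t) \<longlonglongrightarrow> L"
  proof (rule order_tendstoI)
    fix a assume "a < L"
    show "\<forall>\<^sub>F t in sequentially. a < b t / real t"
      using eventually_ge_at_top[of 1] by eventually_elim (use Lle \<open>a < L\<close> in fastforce)
  next
    fix a assume "L < a"
    then obtain m where m: "m \<ge> 1" "b m / real m < a"
      using cInf_lessD[of "(\<lambda>t. b t / real t) ` {1..}" a] by (auto simp: L_def)
    define B where "B = Max (b ` {..<m})"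
    have B: "b i \<le> B" if "i < m" for i
      unfolding B_def using that by (intro Max_ge) auto
    have bound: "b t / real t \<le> b m / real m + B / real t" if "t \<ge> 1" for t
    proof -
      have "b t \<le> real (t div m) * b m + b (t mod m)"
        using mult[of "t div m" m "t mod m"] by simp
      also have "\<dots> \<le> (real t / real m) * b m + B"
        using m b0 by (intro add_mono mult_right_mono B of_nat_div_le_of_nat) auto
      finally show ?thesis
        using that m by (simp add: field_simps)
    qed
    have "(\<lambda>t. b m / real m + B / real t) \<longlonglongrightarrow> b m / real m + 0"
      by (intro tendsto_intros lim_const_over_n)
    then have "\<forall>\<^sub>F t in sequentially. b m / real m + B / real t < a"
      using m by (intro order_tendstoD) auto
    then show "\<forall>\<^sub>F t in sequentially. b t / real t < a"
      using eventually_ge_at_top[of 1] by eventually_elim (use bound in fastforce)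
  qed
  then have "(\<lambda>t. b t / real t - max c 0 / real t) \<longlonglongrightarrow> L - 0"
    by (intro tendsto_diff lim_const_over_n)
  then have "(\<lambda>t. r t / real t) \<longlonglongrightarrow> L"
    by (simp add: b_def diff_divide_distrib[symmetric])
  then show ?thesis
    by (rule convergentI)
qed

section \<open>Covering numbers of the iterates\<close>

locale compact_invariant =
  fixes \<phi> :: "real^'n \<Rightarrow> real^'n" and K :: "(real^'n) set"
  assumes C1: "C1_map \<phi>" and compact: "compact K" and nonempty: "K \<noteq> {}" and invariant: "\<phi> ` K \<subseteq> K"
begin

definition D :: "nat \<Rightarrow> real^'n \<Rightarrow> real^'n^'n" where
  "D t x = jacobian (\<phi> ^^ t) (at x)"

abbreviation N :: "nat \<Rightarrow> real^'n \<Rightarrow> real \<Rightarrow> nat" where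
  "N \<equiv> covering_number \<phi> K"

lemma funpow_in: "x \<in> K \<Longrightarrow> (\<phi> ^^ t) x \<in> K"
  using invariant by (induction t) auto

lemma C1_iterate: "C1_map (\<phi> ^^ t)"
  by (rule C1_funpow[OF C1])

lemma continuous_on_D: "continuous_on S (D t)"
  using C1_iterate[of t] continuous_on_subset unfolding C1_map_def D_def by blast

lemma continuous_on_funpow: "continuous_on S (\<phi> ^^ t)"
  using C1_continuous_on[OF C1_iterate] continuous_on_subset by blast

lemma finite_cover:
  assumes "0 < d"
  shows "\<exists>C. finite C \<and> (\<phi> ^^ t) ` (ball a d \<inter> K) \<subseteq> (\<Union>c\<in>C. ball c d)"
proof -
  obtain C where "finite C" "K \<subseteq> (\<Union>c\<in>C. ball c d)"
    using compact assms unfolding compact_eq_totally_bounded by blast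
  moreover have "(\<phi> ^^ t) ` (ball a d \<inter> K) \<subseteq> K"
    using funpow_in by auto
  ultimately show ?thesis
    by blast
qed

lemma covering_number_attained:
  assumes "0 < d"
  obtains C where "finite C" "card C = N t a d" "(\<phi> ^^ t) ` (ball a d \<inter> K) \<subseteq> (\<Union>c\<in>C. ball c d)"
proof -
  have "\<exists>m. \<exists>C. finite C \<and> card C = m \<and> (\<phi> ^^ t) ` (ball a d \<inter> K) \<subseteq> (\<Union>c\<in>C. ball c d)"
    using finite_cover[OF assms, of t a] by blast
  from LeastI_ex[OF this] show ?thesis
    using that unfolding covering_number_def by blast
qed

lemma covering_number_le:
  assumes "finite C" "(\<phi> ^^ t) ` (ball a d \<inter> K) \<subseteq> (\<Union>c\<in>C. ball c d)"
  shows "N t a d \<le> card C"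
  unfolding covering_number_def by (rule Least_le) (use assms in blast)

lemma covering_number_pos:
  assumes "0 < d" "a \<in> K" shows "1 \<le> N t a d"
proof -
  obtain C where C: "finite C" "card C = N t a d" "(\<phi> ^^ t) ` (ball a d \<inter> K) \<subseteq> (\<Union>c\<in>C. ball c d)"
    using covering_number_attained[OF assms(1)] .
  have "(\<phi> ^^ t) a \<in> (\<Union>c\<in>C. ball c d)"
    by (rule subsetD[OF C(3) imageI]) (simp add: assms)
  then have "C \<noteq> {}"
    by auto
  then have "card C \<noteq> 0"
    using C(1) by simp
  then show ?thesis
    unfolding C(2) by simp
qed

text \<open>The supremum over \<open>K\<close> is taken before the limit in the radius, so
  \<open>d0\<close> must not depend on \<open>a\<close>; \<open>uniform_linearization\<close>
  provides this. Its error, with constant 1, is at most \<open>d\<close> and plays the part of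
  \<open>w\<close> in \<open>linear_image_cover\<close>.\<close>

lemma covering_number_upper:
  "\<exists>d0>0. \<forall>d. 0 < d \<and> d < d0 \<longrightarrow> (\<forall>a\<in>K. real (N t a d) \<le> 6 ^ CARD('n) * sqrt (det (gram (D t a))))"
proof -
  obtain d0 where d0: "d0 > 0" and lin: "\<And>a x. a \<in> K \<Longrightarrow> norm (x - a) < d0 \<Longrightarrow>
      norm ((\<phi> ^^ t) x - (\<phi> ^^ t) a - D t a *v (x - a)) \<le> norm (x - a)"
    using uniform_linearization[OF C1_iterate compact, of 1 t] by (auto simp: D_def)
  have "real (N t a d) \<le> 6 ^ CARD('n) * sqrt (det (gram (D t a)))" if d: "0 < d" "d < d0" and a: "a \<in> K" for a d
  proof -
    have "\<exists>C\<subseteq>(\<phi> ^^ t) ` (ball a d \<inter> K). finite C \<and> real (card C) \<le> 6 ^ CARD('n) * sqrt (det (gram (D t a)))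
        \<and> (\<phi> ^^ t) ` (ball a d \<inter> K) \<subseteq> (\<Union>c\<in>C. ball c d)"
    proof (rule linear_image_cover[OF d(1), where b = "(\<phi> ^^ t) a"])
      fix y assume "y \<in> (\<phi> ^^ t) ` (ball a d \<inter> K)"
      then obtain x where x: "y = (\<phi> ^^ t) x" "norm (x - a) < d"
        by (auto simp: dist_norm norm_minus_commute)
      then have "y = (\<phi> ^^ t) a + (D t a *v (x - a) + (y - (\<phi> ^^ t) a - D t a *v (x - a)))"
        "norm (y - (\<phi> ^^ t) a - D t a *v (x - a)) \<le> d"
        using lin[OF a, of x] d by auto
      then show "\<exists>v w. y = (\<phi> ^^ t) a + (D t a *v v + w) \<and> norm v < d \<and> norm w \<le> d"
        using x(2) by blast
    qed
    then obtain C where "finite C" "real (card C) \<le> 6 ^ CARD('n) * sqrt (det (gram (D t a)))"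
        "(\<phi> ^^ t) ` (ball a d \<inter> K) \<subseteq> (\<Union>c\<in>C. ball c d)"
      by blast
    then show ?thesis
      using covering_number_le[of C t a d] by linarith
  qed
  then show ?thesis
    using d0 by blast
qed

text \<open>One point already bounds the supremum from below, so \<open>d0\<close> may depend on
  \<open>a\<close>. Only images of points of \<open>K\<close> are covered, hence the need for a full
  ball inside \<open>K\<close>. The covering radius, the linearization error and \<open>w\<close>
  contribute \<open>d\<close> each, which makes the radius \<open>3 * d\<close>.\<close>

lemma covering_number_lower:
  assumes a: "a \<in> interior K"
  shows "\<exists>d0>0. \<forall>d. 0 < d \<and> d < d0 \<longrightarrow> sqrt (det (gram (D t a))) \<le> 3 ^ CARD('n) * real (N t a d)"
proof -
  obtain d1 where d1: "d1 > 0" "ball a d1 \<subseteq> K"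
    using a by (auto simp: mem_interior)
  then have aK: "a \<in> K"
    by auto
  obtain d0 where d0: "d0 > 0" and lin: "\<And>a x. a \<in> K \<Longrightarrow> norm (x - a) < d0 \<Longrightarrow>
      norm ((\<phi> ^^ t) x - (\<phi> ^^ t) a - D t a *v (x - a)) \<le> norm (x - a)"
    using uniform_linearization[OF C1_iterate compact, of 1 t] by (auto simp: D_def)
  have "sqrt (det (gram (D t a))) \<le> 3 ^ CARD('n) * real (N t a d)" if d: "0 < d" "d < min d0 d1" for d
  proof -
    obtain C where C: "finite C" "card C = N t a d" "(\<phi> ^^ t) ` (ball a d \<inter> K) \<subseteq> (\<Union>c\<in>C. ball c d)"
      using covering_number_attained[OF d(1)] .
    have "(\<phi> ^^ t) a + (D t a *v v + w) \<in> (\<Union>c\<in>C. ball c (3 * d))" if v: "norm v < d" and w: "norm w < d" for v w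
    proof -
      have "a + v \<in> ball a d \<inter> K"
        using v d d1(2) by (auto simp: dist_norm subset_iff)
      then have "(\<phi> ^^ t) (a + v) \<in> (\<Union>c\<in>C. ball c d)"
        by (rule subsetD[OF C(3) imageI])
      then obtain c where c: "c \<in> C" "dist c ((\<phi> ^^ t) (a + v)) < d"
        by auto
      have "norm ((\<phi> ^^ t) (a + v) - (\<phi> ^^ t) a - D t a *v v) < d"
        using lin[OF aK, of "a + v"] v d by simp
      moreover have "(\<phi> ^^ t) (a + v) - ((\<phi> ^^ t) a + (D t a *v v + w))
          = ((\<phi> ^^ t) (a + v) - (\<phi> ^^ t) a - D t a *v v) - w"
        by simp
      ultimately have "dist ((\<phi> ^^ t) (a + v)) ((\<phi> ^^ t) a + (D t a *v v + w)) < 2 * d"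
        unfolding dist_norm using w norm_triangle_ineq4 by (smt (verit))
      then have "dist c ((\<phi> ^^ t) a + (D t a *v v + w)) < 3 * d"
        using c(2) dist_triangle[of c "(\<phi> ^^ t) a + (D t a *v v + w)" "(\<phi> ^^ t) (a + v)"] by linarith
      then show ?thesis
        using c(1) by auto
    qed
    then have "sqrt (det (gram (D t a))) * d ^ CARD('n) \<le> real (card C) * (3 * d) ^ CARD('n)"
      using C(1) d by (intro linear_image_cover_card_ge) auto
    then have "sqrt (det (gram (D t a))) * d ^ CARD('n) \<le> (3 ^ CARD('n) * real (N t a d)) * d ^ CARD('n)"
      by (simp add: C(2) power_mult_distrib mult_ac)
    then show ?thesis
      using d(1) by (simp only: mult_le_cancel_right_pos zero_less_power)
  qed
  then show ?thesis
    using d0 d1(1) by (intro exI[of _ "min d0 d1"]) auto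
qed

text \<open>This moves centres into \<open>K\<close>, where a uniform bound on covering numbers is
  available. Balls of radius \<open>d / 2\<close> around points of the set lie in one of radius
  \<open>3 / 2 * d\<close>, whence the base 3.\<close>

lemma ball_cover_in:
  assumes d: "0 < d"
  shows "\<exists>C\<subseteq>ball c d \<inter> K. finite C \<and> real (card C) \<le> 3 ^ CARD('n) \<and> ball c d \<inter> K \<subseteq> (\<Union>c\<in>C. ball c d)"
proof (rule cover_by_packing[OF d])
  show "ball c (3 / 2 * d) \<in> lmeasurable"
    by (rule lmeasurable_ball)
  show "(\<Union>y\<in>ball c d \<inter> K. ball y (d / 2)) \<subseteq> ball c (3 / 2 * d)"
  proof clarify
    fix y p assume "y \<in> ball c d" "p \<in> ball y (d / 2)"
    then show "p \<in> ball c (3 / 2 * d)"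
      using dist_triangle[of c p y] by simp
  qed
  have "(3 / 2 * d) ^ CARD('n) = 3 ^ CARD('n) * (d / 2) ^ CARD('n)"
    using power_mult_distrib[of 3 "d / 2" "CARD('n)"] by simp
  then show "measure lebesgue (ball c (3 / 2 * d))
      \<le> 3 ^ CARD('n) * ((d / 2) ^ CARD('n) * measure lebesgue (ball (0::real^'n) 1))"
    using d by (subst measure_ball_cart) (auto simp: mult.assoc)
qed

lemma covering_number_add:
  assumes d: "0 < d" and B: "\<And>b. b \<in> K \<Longrightarrow> real (N s b d) \<le> B" and B0: "0 \<le> B"
  shows "real (N (s + t) a d) \<le> real (N t a d) * 3 ^ CARD('n) * B"
proof -
  obtain C where C: "finite C" "card C = N t a d" "(\<phi> ^^ t) ` (ball a d \<inter> K) \<subseteq> (\<Union>c\<in>C. ball c d)"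
    using covering_number_attained[OF d] .
  obtain E where E: "\<And>c. E c \<subseteq> ball c d \<inter> K" "\<And>c. finite (E c)" "\<And>c. real (card (E c)) \<le> 3 ^ CARD('n)"
    "\<And>c. ball c d \<inter> K \<subseteq> (\<Union>e\<in>E c. ball e d)"
    using ball_cover_in[OF d] by metis
  have "\<exists>G. finite G \<and> card G = N s e d \<and> (\<phi> ^^ s) ` (ball e d \<inter> K) \<subseteq> (\<Union>g\<in>G. ball g d)" for e
  proof -
    obtain G where "finite G" "card G = N s e d" "(\<phi> ^^ s) ` (ball e d \<inter> K) \<subseteq> (\<Union>g\<in>G. ball g d)"
      using covering_number_attained[OF d] .
    then show ?thesis
      by blast
  qed
  then obtain G where G: "\<And>e. finite (G e)" "\<And>e. card (G e) = N s e d"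
    "\<And>e. (\<phi> ^^ s) ` (ball e d \<inter> K) \<subseteq> (\<Union>g\<in>G e. ball g d)"
    by metis
  define F where "F = (\<Union>c\<in>C. \<Union>e\<in>E c. G e)"
  have "finite F"
    using C E G by (auto simp: F_def)
  moreover have "(\<phi> ^^ (s + t)) ` (ball a d \<inter> K) \<subseteq> (\<Union>c\<in>F. ball c d)"
  proof clarify
    fix x assume x: "x \<in> ball a d" "x \<in> K"
    then obtain c where c: "c \<in> C" "(\<phi> ^^ t) x \<in> ball c d"
      using C(3) by blast
    then obtain e where e: "e \<in> E c" "(\<phi> ^^ t) x \<in> ball e d"
      using E(4)[of c] funpow_in[OF x(2)] by blast
    then obtain g where g: "g \<in> G e" "(\<phi> ^^ s) ((\<phi> ^^ t) x) \<in> ball g d"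
      using G(3)[of e] funpow_in[OF x(2)] by blast
    then show "(\<phi> ^^ (s + t)) x \<in> (\<Union>c\<in>F. ball c d)"
      using c e unfolding F_def funpow_add comp_def by blast
  qed
  ultimately have "real (N (s + t) a d) \<le> real (card F)"
    using covering_number_le by simp
  also have "\<dots> \<le> (\<Sum>c\<in>C. \<Sum>e\<in>E c. real (card (G e)))"
  proof -
    have "card F \<le> (\<Sum>c\<in>C. card (\<Union>e\<in>E c. G e))"
      unfolding F_def by (rule card_UN_le[OF C(1)])
    also have "\<dots> \<le> (\<Sum>c\<in>C. \<Sum>e\<in>E c. card (G e))"
      by (intro sum_mono card_UN_le E)
    finally show ?thesis
      unfolding of_nat_sum[symmetric] of_nat_le_iff .
  qed
  also have "\<dots> \<le> (\<Sum>c\<in>C. \<Sum>e\<in>E c. B)"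
    using E(1) by (intro sum_mono) (use B G(2) in auto)
  also have "\<dots> \<le> (\<Sum>c\<in>C. 3 ^ CARD('n) * B)"
    using E(3) B0 by (intro sum_mono) (simp add: mult_right_mono)
  also have "\<dots> = real (N t a d) * 3 ^ CARD('n) * B"
    by (simp add: C(2))
  finally show ?thesis .
qed

section \<open>From covering numbers to the entropy\<close>

definition log_covering :: "nat \<Rightarrow> real \<Rightarrow> ereal" where
  "log_covering t d = (SUP a\<in>K. elog2 (real (N t a d)))"

definition local_entropy :: "nat \<Rightarrow> ereal" where
  "local_entropy t = Limsup (at_right 0) (log_covering t)"

lemma log_covering_le_iff:
  assumes "0 < d"
  shows "log_covering t d \<le> ereal u \<longleftrightarrow> (\<forall>a\<in>K. real (N t a d) \<le> 2 powr u)"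
proof -
  have "elog2 (real (N t a d)) \<le> ereal u \<longleftrightarrow> real (N t a d) \<le> 2 powr u" if "a \<in> K" for a
    using covering_number_pos[OF assms that, of t] by (auto simp: elog2_def log_le_iff)
  then show ?thesis
    unfolding log_covering_def by (auto simp: SUP_le_iff)
qed

lemma eventually_pos_at_right: "\<forall>\<^sub>F d in at_right (0::real). 0 < d"
  by (rule eventually_at_right_less)

lemma local_entropy_less:
  assumes "local_entropy t < ereal u"
  shows "\<forall>\<^sub>F d in at_right 0. 0 < d \<and> (\<forall>a\<in>K. real (N t a d) \<le> 2 powr u)"
proof -
  have "\<forall>\<^sub>F d in at_right 0. log_covering t d < ereal u"
    using assms unfolding local_entropy_def by (rule Limsup_lessD)
  with eventually_pos_at_right show ?thesis
    by eventually_elim (metis log_covering_le_iff less_imp_le)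
qed

lemma local_entropy_le:
  assumes "\<forall>\<^sub>F d in at_right 0. 0 < d \<longrightarrow> (\<forall>a\<in>K. real (N t a d) \<le> 2 powr u)"
  shows "local_entropy t \<le> ereal u"
  unfolding local_entropy_def
proof (rule Limsup_bounded)
  show "\<forall>\<^sub>F d in at_right 0. log_covering t d \<le> ereal u"
    using assms eventually_pos_at_right by eventually_elim (simp add: log_covering_le_iff)
qed

lemma local_entropy_upper:
  assumes "\<And>a. a \<in> K \<Longrightarrow> 6 ^ CARD('n) * sqrt (det (gram (D t a))) \<le> 2 powr u"
  shows "local_entropy t \<le> ereal u"
proof (rule local_entropy_le)
  obtain d0 where d0: "d0 > 0"
    "\<And>d a. 0 < d \<Longrightarrow> d < d0 \<Longrightarrow> a \<in> K \<Longrightarrow> real (N t a d) \<le> 6 ^ CARD('n) * sqrt (det (gram (D t a)))"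
    using covering_number_upper[of t] by blast
  then show "\<forall>\<^sub>F d in at_right 0. 0 < d \<longrightarrow> (\<forall>a\<in>K. real (N t a d) \<le> 2 powr u)"
    unfolding eventually_at_right_field using assms order_trans by blast
qed

lemma local_entropy_lower:
  assumes less: "local_entropy t < ereal u" and a: "a \<in> interior K"
  shows "sqrt (det (gram (D t a))) \<le> 3 ^ CARD('n) * 2 powr u"
proof -
  obtain d0 where d0: "d0 > 0" "\<And>d. 0 < d \<Longrightarrow> d < d0 \<Longrightarrow> sqrt (det (gram (D t a))) \<le> 3 ^ CARD('n) * real (N t a d)"
    using covering_number_lower[OF a, of t] by blast
  then have "\<forall>\<^sub>F d in at_right 0. sqrt (det (gram (D t a))) \<le> 3 ^ CARD('n) * real (N t a d)"
    unfolding eventually_at_right_field by blast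
  with local_entropy_less[OF less]
  have "\<forall>\<^sub>F d::real in at_right 0. sqrt (det (gram (D t a))) \<le> 3 ^ CARD('n) * 2 powr u"
  proof eventually_elim
    case (elim d)
    have "real (N t a d) \<le> 2 powr u"
      using elim a interior_subset by blast
    then have "3 ^ CARD('n) * real (N t a d) \<le> 3 ^ CARD('n) * 2 powr u"
      by simp
    then show ?case
      using elim(2) by linarith
  qed
  \<comment> \<open>The inequality no longer contains \<open>d\<close>, and the filter is proper, so
    it holds outright.\<close>
  then show ?thesis
    by (simp add: trivial_limit_at_right_real)
qed

lemma local_entropy_add:
  assumes "local_entropy s < ereal u" "local_entropy t < ereal v"
  shows "local_entropy (s + t) \<le> ereal (u + v + CARD('n) * log 2 3)"
proof (rule local_entropy_le)
  show "\<forall>\<^sub>F d in at_right 0. 0 < d \<longrightarrow> (\<forall>a\<in>K. real (N (s + t) a d) \<le> 2 powr (u + v + CARD('n) * log 2 3))"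
    using local_entropy_less[OF assms(1)] local_entropy_less[OF assms(2)]
  proof eventually_elim
    case (elim d)
    show ?case
    proof (intro impI ballI)
      fix a assume a: "a \<in> K"
      have "real (N (s + t) a d) \<le> real (N t a d) * 3 ^ CARD('n) * 2 powr u"
        using elim by (intro covering_number_add) auto
      also have "\<dots> \<le> 2 powr v * 3 ^ CARD('n) * 2 powr u"
        using elim a by (intro mult_right_mono) auto
      also have "(3::real) ^ CARD('n) = (2 powr log 2 3) powr real CARD('n)"
        by (simp add: powr_realpow)
      also have "\<dots> = 2 powr (CARD('n) * log 2 3)"
        by (simp only: powr_powr mult.commute)
      finally show "real (N (s + t) a d) \<le> 2 powr (u + v + CARD('n) * log 2 3)"
        by (simp add: powr_add mult_ac)
    qed
  qed
qed

lemma continuous_on_det_gram: "continuous_on S (\<lambda>x. det (gram (D t x)))"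
  unfolding gram_def
  by (intro continuous_on_det continuous_on_add continuous_on_const continuous_on_matrix_mult
      continuous_on_transpose continuous_on_D)

lemma local_entropy_real: "\<exists>r\<ge>0. local_entropy t = ereal r"
proof -
  obtain x where x: "\<And>a. a \<in> K \<Longrightarrow> det (gram (D t a)) \<le> det (gram (D t x))"
    using continuous_attains_sup[OF compact nonempty continuous_on_det_gram] by blast
  define M where "M = 6 ^ CARD('n) * sqrt (det (gram (D t x)))"
  have M: "M > 0"
    using det_pos_def[OF pos_def_gram, of "D t x"] by (simp add: M_def)
  have "local_entropy t \<le> ereal (log 2 M)"
    using M x by (intro local_entropy_upper) (simp add: M_def)
  moreover have "0 \<le> local_entropy t"
    unfolding local_entropy_def
  proof (rule le_Limsup)
    show "\<forall>\<^sub>F d in at_right 0. 0 \<le> log_covering t d"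
      using eventually_pos_at_right
    proof eventually_elim
      case (elim d)
      obtain a where a: "a \<in> K"
        using nonempty by blast
      have "0 \<le> elog2 (real (N t a d))"
        using covering_number_pos[OF elim a, of t] by (simp add: elog2_def)
      also have "\<dots> \<le> log_covering t d"
        unfolding log_covering_def using a by (rule SUP_upper)
      finally show ?case .
    qed
  qed (simp add: trivial_limit_at_right_real)
  ultimately show ?thesis
    by (cases "local_entropy t") auto
qed

text \<open>The \<open>lim\<close> in the definition of the entropy is informative only for a
  convergent sequence. Convergence comes from \<open>fekete_almost_subadditive\<close> with defect
  \<open>CARD('n) * log 2 3\<close>, the logarithm of the recentring factor.\<close>

lemma restoration_entropy_limit:
  obtains r H where "\<forall>t. local_entropy t = ereal (r t)" "(\<lambda>t. r t / real t) \<longlonglongrightarrow> H"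
    "restoration_entropy \<phi> K = ereal H"
proof -
  obtain r where r: "\<And>t. 0 \<le> r t" "\<And>t. local_entropy t = ereal (r t)"
    using local_entropy_real by metis
  have "r (s + t) \<le> r s + r t + CARD('n) * log 2 3" for s t
  \<comment> \<open>\<open>local_entropy_add\<close> asks for strict bounds on both terms, which the
    two halves of \<open>e\<close> supply.\<close>
  proof (rule field_le_epsilon)
    fix e :: real assume e: "0 < e"
    have "local_entropy (s + t) \<le> ereal ((r s + e / 2) + (r t + e / 2) + CARD('n) * log 2 3)"
      using e by (intro local_entropy_add) (auto simp: r)
    then show "r (s + t) \<le> r s + r t + CARD('n) * log 2 3 + e"
      by (simp add: r)
  qed
  then have "convergent (\<lambda>t. r t / real t)"
    using r(1) by (rule fekete_almost_subadditive)
  then obtain H where H: "(\<lambda>t. r t / real t) \<longlonglongrightarrow> H"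
    unfolding convergent_def by blast
  have "restoration_entropy \<phi> K = lim (\<lambda>t. ereal (1 / real t) * local_entropy t)"
    by (simp add: restoration_entropy_def local_entropy_def log_covering_def[abs_def])
  also have "\<dots> = lim (\<lambda>t. ereal (r t / real t))"
    by (simp add: r)
  also have "\<dots> = ereal H"
    using H by (intro limI) (simp add: lim_ereal)
  finally show ?thesis
    using that r(2) H by blast
qed

end

subsection \<open>Adapted metrics\<close>

text \<open>Without a maximum, every point has a neighbourhood on which \<open>s\<close> stays below
  some value \<open>s (g x)\<close>. Finitely many neighbourhoods cover \<open>K\<close>; the point
  realizing the largest of these values lies in one of them and is beaten by a larger one.\<close>

lemma upper_semicontinuous_attains_sup:
  fixes s :: "'a::topological_space \<Rightarrow> 'b::linorder"
  assumes K: "compact K" "K \<noteq> {}"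
    and usc: "\<And>x y. x \<in> K \<Longrightarrow> y \<in> K \<Longrightarrow> s x < s y \<Longrightarrow> \<forall>\<^sub>F z in at x within K. s z < s y"
  shows "\<exists>x\<in>K. \<forall>y\<in>K. s y \<le> s x"
proof (rule ccontr)
  assume "\<not> ?thesis"
  then have "\<forall>x\<in>K. \<exists>y\<in>K. s x < s y"
    by (auto simp: not_le)
  then obtain g where g: "\<And>x. x \<in> K \<Longrightarrow> g x \<in> K \<and> s x < s (g x)"
    by metis
  have "\<exists>U. open U \<and> x \<in> U \<and> (\<forall>z\<in>U \<inter> K. s z < s (g x))" if x: "x \<in> K" for x
  proof -
    obtain U where "open U" "x \<in> U" "\<And>z. z \<in> U \<Longrightarrow> z \<noteq> x \<Longrightarrow> z \<in> K \<Longrightarrow> s z < s (g x)"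
      using usc[of x "g x"] g[OF x] x unfolding eventually_at_topological by blast
    then show ?thesis
      using g[OF x] by blast
  qed
  then obtain U where U: "\<And>x. x \<in> K \<Longrightarrow> open (U x) \<and> x \<in> U x \<and> (\<forall>z\<in>U x \<inter> K. s z < s (g x))"
    by metis
  obtain F where F: "F \<subseteq> K" "finite F" "K \<subseteq> (\<Union>x\<in>F. U x)"
    using compactE_image[OF K(1), of K U] U by blast
  have "F \<noteq> {}"
    using F K by auto
  then have "Max ((\<lambda>x. s (g x)) ` F) \<in> (\<lambda>x. s (g x)) ` F"
    using F by (intro Max_in) auto
  then obtain x where x: "x \<in> F" "s (g x) = Max ((\<lambda>x. s (g x)) ` F)"
    by force
  have gxK: "g x \<in> K"
    using g F(1) x(1) by blast
  then obtain y where y: "y \<in> F" "g x \<in> U y"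
    using F(3) by blast
  then have "s (g x) < s (g y)"
    using U[of y] F(1) gxK by blast
  also have "s (g y) \<le> s (g x)"
    unfolding x(2) using F y by (intro Max_ge) auto
  finally show False
    by simp
qed

section \<open>Metrics on \<open>K\<close>, their pullbacks and the upper bound\<close>

context compact_invariant
begin

definition metric :: "(real^'n \<Rightarrow> real^'n^'n) \<Rightarrow> bool" where
  "metric P \<longleftrightarrow> continuous_on K P \<and> P ` K \<subseteq> pos_def_matrices"

definition pullback :: "nat \<Rightarrow> (real^'n \<Rightarrow> real^'n^'n) \<Rightarrow> real^'n \<Rightarrow> real^'n^'n" where
  "pullback t P x = transpose (D t x) ** P ((\<phi> ^^ t) x) ** D t x"

text \<open>The analogue over \<open>t\<close> steps of
  \<open>Sigma_metric P \<phi> x \<le> log 4 c\<close> for all \<open>x\<close> in \<open>K\<close>;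
  by \<open>Sigma_metric_le\<close> it is that very bound when \<open>t = 1\<close> and
  \<open>c > 0\<close>.\<close>

definition displaced :: "nat \<Rightarrow> (real^'n \<Rightarrow> real^'n^'n) \<Rightarrow> real \<Rightarrow> bool" where
  "displaced t P c \<longleftrightarrow> (\<forall>x\<in>K. expansion_le (P x) (pullback t P x) c)"

lemma metric_pos_def: "metric P \<Longrightarrow> x \<in> K \<Longrightarrow> P x \<in> pos_def_matrices"
  by (auto simp: metric_def)

lemma D_0: "D 0 x = mat 1"
  using jacobian_id by (simp add: D_def id_def)

lemma D_1: "D 1 x = jacobian \<phi> (at x)"
  by (simp add: D_def)

lemma D_add: "D (s + t) x = D s ((\<phi> ^^ t) x) ** D t x"
  unfolding D_def by (rule jacobian_funpow_add[OF C1])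

lemma pullback_add: "pullback (s + t) P x = transpose (D t x) ** pullback s P ((\<phi> ^^ t) x) ** D t x"
  by (simp add: pullback_def D_add matrix_transpose_mul matrix_mul_assoc funpow_add)

lemma continuous_on_pullback:
  assumes "continuous_on K P"
  shows "continuous_on K (pullback t P)"
proof -
  have "continuous_on K (\<lambda>x. P ((\<phi> ^^ t) x))"
    using funpow_in by (intro continuous_on_compose2[OF assms continuous_on_funpow]) auto
  then show ?thesis
    unfolding pullback_def[abs_def]
    by (intro continuous_on_matrix_mult continuous_on_transpose continuous_on_D)
qed

lemma displaced_iterate:
  assumes P: "metric P" and c: "displaced 1 P c"
  shows "displaced t P (c ^ t)"
proof (induction t)
  case 0
  have "pullback 0 P x = P x" for x
    by (simp add: pullback_def D_0 transpose_mat)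
  moreover have "expansion_le (P x) (P x) 1" if "x \<in> K" for x
    using metric_pos_def[OF P that] loewner_refl by (auto simp: expansion_le_def pos_def_quad)
  ultimately show ?case
    by (simp add: displaced_def)
next
  case (Suc t)
  show ?case
    unfolding displaced_def
  proof
    fix x assume x: "x \<in> K"
    then have y: "\<phi> x \<in> K"
      using invariant by blast
    have 1: "expansion_le (P x) (transpose (D 1 x) ** P (\<phi> x) ** D 1 x) c"
      using c x by (simp add: displaced_def pullback_def)
    have 2: "expansion_le (P (\<phi> x)) (pullback t P (\<phi> x)) (c ^ t)"
      using Suc y by (simp add: displaced_def)
    have "pullback (Suc t) P x = transpose (D 1 x) ** pullback t P (\<phi> x) ** D 1 x"
      using pullback_add[of t 1 P x] by simp
    then show "expansion_le (P x) (pullback (Suc t) P x) (c ^ Suc t)"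
      using expansion_le_trans[OF metric_pos_def[OF P x] metric_pos_def[OF P y] 1 2] by simp
  qed
qed

lemma Sigma_metric_real:
  assumes "metric P" "x \<in> K"
  shows "\<exists>s\<ge>0. Sigma_metric P \<phi> x = ereal s"
  using assms invariant by (intro Sigma_metric_le_iff(1) metric_pos_def) auto

lemma Sigma_metric_le:
  assumes "metric P" "x \<in> K"
  shows "Sigma_metric P \<phi> x \<le> ereal s \<longleftrightarrow> expansion_le (P x) (pullback 1 P x) (4 powr s)"
  using Sigma_metric_le_iff(2)[of P x \<phi> s] assms invariant
  by (auto simp: pullback_def metric_pos_def image_subset_iff simp flip: D_1)

lemma Sigma_metric_attains_max:
  assumes P: "metric P"
  shows "\<exists>x\<in>K. \<forall>y\<in>K. Sigma_metric P \<phi> y \<le> Sigma_metric P \<phi> x"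
proof (rule upper_semicontinuous_attains_sup[OF compact nonempty])
  fix x y assume x: "x \<in> K" and y: "y \<in> K" and less: "Sigma_metric P \<phi> x < Sigma_metric P \<phi> y"
  obtain s s' where s: "Sigma_metric P \<phi> x = ereal s" "Sigma_metric P \<phi> y = ereal s'"
    using Sigma_metric_real[OF P] x y by metis
  \<comment> \<open>A value strictly between the two leaves the room that
    \<open>eventually_expansion_le\<close> consumes.\<close>
  define u where "u = (s + s') / 2"
  have u: "s < u" "u < s'"
    using less s by (auto simp: u_def)
  have cont: "continuous_on K P"
    using P by (simp add: metric_def)
  have "\<forall>\<^sub>F z in at x within K. expansion_le (P z) (pullback 1 P z) (4 powr u)"
  proof (rule eventually_expansion_le[OF metric_pos_def[OF P x]])
    show "expansion_le (P x) (pullback 1 P x) (4 powr s)"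
      using Sigma_metric_le[OF P x, of s] s by simp
    show "4 powr s < 4 powr u"
      using u by simp
    show "(P \<longlongrightarrow> P x) (at x within K)" "(pullback 1 P \<longlongrightarrow> pullback 1 P x) (at x within K)"
      using cont continuous_on_pullback[OF cont] x by (auto simp: continuous_on_def)
  qed
  moreover have "\<forall>\<^sub>F z in at x within K. z \<in> K"
    by (simp add: eventually_at_filter)
  ultimately show "\<forall>\<^sub>F z in at x within K. Sigma_metric P \<phi> z < Sigma_metric P \<phi> y"
  proof eventually_elim
    case (elim z)
    then have "Sigma_metric P \<phi> z \<le> ereal u"
      using Sigma_metric_le[OF P] by blast
    also have "\<dots> < Sigma_metric P \<phi> y"
      using u s by simp
    finally show ?case .
  qed
qed

lemma metric_uniform_lower_bound:
  assumes P: "metric P"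
  shows "\<exists>m>0. \<forall>x\<in>K. \<forall>v. m * (norm v)\<^sup>2 \<le> quad (P x) v"
proof -
  have "continuous_on (K \<times> sphere 0 1) (\<lambda>z. P (fst z))"
    using P unfolding metric_def
    by (intro continuous_on_compose2[OF _ continuous_on_fst[OF continuous_on_id]]) auto
  then have "continuous_on (K \<times> sphere 0 1) (\<lambda>z. quad (P (fst z)) (snd z))"
    unfolding quad_def inner_vec_def matrix_vector_mult_def
    by (simp, intro continuous_intros)
  moreover have "compact (K \<times> sphere (0::real^'n) 1)"
    by (intro compact_Times compact compact_sphere)
  moreover have "K \<times> sphere (0::real^'n) 1 \<noteq> {}"
    using nonempty by simp
  ultimately obtain z where z: "z \<in> K \<times> sphere 0 1"
    and zmin: "\<And>y. y \<in> K \<times> sphere 0 1 \<Longrightarrow> quad (P (fst z)) (snd z) \<le> quad (P (fst y)) (snd y)"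
    using continuous_attains_inf[of "K \<times> sphere 0 1" "\<lambda>z. quad (P (fst z)) (snd z)"] by blast
  define m where "m = quad (P (fst z)) (snd z)"
  have "fst z \<in> K" "snd z \<noteq> 0"
    using z by (auto simp: mem_Times_iff)
  then have "m > 0"
    using metric_pos_def[OF P] unfolding m_def pos_def_quad by blast
  moreover have "m * (norm v)\<^sup>2 \<le> quad (P x) v" if x: "x \<in> K" for x v
  proof (cases "v = 0")
    case False
    have "m \<le> quad (P x) (inverse (norm v) *\<^sub>R v)"
      using zmin[of "(x, inverse (norm v) *\<^sub>R v)"] x False by (simp add: m_def)
    then show ?thesis
      using False by (simp add: quad_scaleR_vector power_inverse field_simps)
  qed (simp add: quad_def)
  ultimately show ?thesis
    by blast
qed

lemma four_powr: "4 powr s = (2 powr s)\<^sup>2" for s :: real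
  by (simp add: power2_eq_square flip: powr_mult)

text \<open>Iterating the bound for one step controls \<open>t\<close> steps in the metric
  \<open>P\<close>. The lower bound \<open>m\<close> and the largest \<open>det (P x)\<close> on
  \<open>K\<close> translate this to the Euclidean metric with a constant \<open>C\<close>
  independent of \<open>t\<close>, which is lost in the limit.\<close>

lemma restoration_entropy_le:
  assumes P: "metric P" and le: "\<And>x. x \<in> K \<Longrightarrow> Sigma_metric P \<phi> x \<le> ereal s"
  shows "restoration_entropy \<phi> K \<le> ereal s"
proof -
  obtain m where m: "m > 0" "\<And>x v. x \<in> K \<Longrightarrow> m * (norm v)\<^sup>2 \<le> quad (P x) v"
    using metric_uniform_lower_bound[OF P] by blast
  have "continuous_on K (\<lambda>x. det (P x))"
    using P by (intro continuous_on_det) (simp add: metric_def)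
  then obtain x0 where x0: "x0 \<in> K" "\<And>x. x \<in> K \<Longrightarrow> det (P x) \<le> det (P x0)"
    using continuous_attains_sup[OF compact nonempty] by blast
  define C where "C = (2 / m) ^ CARD('n) * det (P x0)"
  have C: "C > 0"
    using m det_pos_def[OF metric_pos_def[OF P x0(1)]] by (simp add: C_def)
  have "displaced 1 P (4 powr s)"
    using le Sigma_metric_le[OF P] by (auto simp: displaced_def)
  note disp = displaced_iterate[OF P this]
  have det: "det (gram (D t x)) \<le> C * ((2 powr s)\<^sup>2) ^ t" if x: "x \<in> K" for t x
  proof -
    obtain R where R: "transpose R = R" "P x \<preceq> R" "pullback t P x \<preceq> R" "det R \<le> (4 powr s) ^ t * det (P x)"
      using disp[of t] x unfolding displaced_def expansion_le_def by blast
    \<comment> \<open>\<open>R\<close> dominates \<open>P x\<close> and the pullback, each of them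
      at least \<open>m\<close> times its Euclidean counterpart; adding the two bounds produces the
      factor 2.\<close>
    have quads: "quad (mat 1 + transpose (D t x) ** D t x) v \<le> quad ((2 / m) *\<^sub>R R) v" for v
    proof -
      have "m * (norm v)\<^sup>2 \<le> quad R v"
        using m(2)[OF x, of v] R(2) unfolding loewner_le_def by (meson order_trans)
      moreover have "m * (norm (D t x *v v))\<^sup>2 \<le> quad R v"
        using m(2)[OF funpow_in[OF x], of "D t x *v v" t] R(3)
        unfolding loewner_le_def pullback_def quad_congruence by (meson order_trans)
      ultimately show ?thesis
        using m(1) by (simp add: quad_add quad_mat_1 quad_transpose_mult quad_scaleR field_simps)
    qed
    have "det (gram (D t x)) = det (gram (transpose (D t x)))"
      unfolding det_gram_transpose[of "D t x"] by (simp add: gram_def)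
    also have "\<dots> \<le> det ((2 / m) *\<^sub>R R)"
      using quads R(1) by (intro det_mono pos_def_gram) (auto simp: gram_def loewner_le_def transpose_scalar)
    also have "\<dots> \<le> (2 / m) ^ CARD('n) * ((4 powr s) ^ t * det (P x))"
      unfolding det_scaleR using R(4) m(1) by (intro mult_left_mono) auto
    also have "\<dots> \<le> (2 / m) ^ CARD('n) * ((4 powr s) ^ t * det (P x0))"
      using x0(2)[OF x] m(1) by (intro mult_left_mono) auto
    also have "\<dots> = C * ((2 powr s)\<^sup>2) ^ t"
      by (simp add: C_def four_powr)
    finally show ?thesis .
  qed
  define A where "A = log 2 (6 ^ CARD('n) * sqrt C)"
  have bound: "local_entropy t \<le> ereal (A + s * real t)" for t
  proof (rule local_entropy_upper)
    fix x assume "x \<in> K"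
    then have "sqrt (det (gram (D t x))) \<le> sqrt (C * ((2 powr s)\<^sup>2) ^ t)"
      using det by simp
    also have "\<dots> = sqrt C * (2 powr s) ^ t"
      by (simp add: real_sqrt_mult real_sqrt_power)
    finally have "6 ^ CARD('n) * sqrt (det (gram (D t x))) \<le> (6 ^ CARD('n) * sqrt C) * (2 powr s) ^ t"
      by simp
    also have "\<dots> = 2 powr A * 2 powr (s * real t)"
      using C by (simp add: A_def powr_realpow[symmetric] powr_powr)
    finally show "6 ^ CARD('n) * sqrt (det (gram (D t x))) \<le> 2 powr (A + s * real t)"
      by (simp add: powr_add)
  qed
  obtain r H where r: "\<forall>t. local_entropy t = ereal (r t)" and H: "(\<lambda>t. r t / real t) \<longlonglongrightarrow> H"
    and ent: "restoration_entropy \<phi> K = ereal H"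
    using restoration_entropy_limit .
  have "(\<lambda>t. A / real t + s) \<longlonglongrightarrow> 0 + s"
    by (intro tendsto_intros lim_const_over_n)
  moreover have "\<exists>N. \<forall>t\<ge>N. r t / real t \<le> A / real t + s"
  proof (intro exI[of _ 1] allI impI)
    fix t :: nat assume t: "1 \<le> t"
    have "r t \<le> A + s * real t"
      using bound[of t] r by simp
    then show "r t / real t \<le> A / real t + s"
      using t by (simp add: field_simps)
  qed
  ultimately have "H \<le> 0 + s"
    using H LIMSEQ_le by blast
  then show ?thesis
    by (simp add: ent)
qed

end

section \<open>Halving the number of steps and the lower bound\<close>

locale compact_invariant_immersion = compact_invariant \<phi> K
  for \<phi> :: "real^'n \<Rightarrow> real^'n" and K +
  assumes invertible_jacobian: "x \<in> K \<Longrightarrow> invertible (jacobian \<phi> (at x))"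
begin

lemma invertible_D: "x \<in> K \<Longrightarrow> invertible (D t x)"
proof (induction t)
  case 0
  show ?case
    unfolding D_0 invertible_det_nz by simp
next
  case (Suc t)
  have "D (Suc t) x = D 1 ((\<phi> ^^ t) x) ** D t x"
    using D_add[of 1 t x] by simp
  then show ?case
    using Suc invertible_jacobian[OF funpow_in[OF Suc.prems]] by (simp only: D_1 invertible_mult)
qed

text \<open>This is the use of invertibility: geometric means are formed only of positive definite
  matrices.\<close>

lemma pullback_pos_def: "metric P \<Longrightarrow> x \<in> K \<Longrightarrow> pullback t P x \<in> pos_def_matrices"
  unfolding pullback_def by (intro pos_def_congruence metric_pos_def funpow_in invertible_D)

text \<open>The two geometric means to be compared, \<open>P' x\<close> and its pullback, share the argument
  \<open>pullback t P x\<close>.\<close>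

lemma displaced_halve:
  assumes P: "metric P" and disp: "displaced (t + t) P c"
  shows "\<exists>P'. metric P' \<and> displaced t P' (sqrt c)"
proof (intro exI conjI)
  define P' where "P' x = gmean (P x) (pullback t P x)" for x
  have cont: "continuous_on K P"
    using P by (simp add: metric_def)
  have "continuous_on K P'"
    unfolding continuous_on_def P'_def
  proof
    fix x assume x: "x \<in> K"
    have ev: "\<forall>\<^sub>F z in at x within K. z \<in> K"
      by (simp add: eventually_at_filter)
    show "((\<lambda>z. gmean (P z) (pullback t P z)) \<longlongrightarrow> gmean (P x) (pullback t P x)) (at x within K)"
    proof (rule tendsto_gmean[OF metric_pos_def[OF P x] pullback_pos_def[OF P x]])
      show "(P \<longlongrightarrow> P x) (at x within K)" "(pullback t P \<longlongrightarrow> pullback t P x) (at x within K)"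
        using cont continuous_on_pullback[OF cont] x by (auto simp: continuous_on_def)
      show "\<forall>\<^sub>F z in at x within K. P z \<in> pos_def_matrices"
        "\<forall>\<^sub>F z in at x within K. pullback t P z \<in> pos_def_matrices"
        using ev by (eventually_elim, simp add: metric_pos_def[OF P] pullback_pos_def[OF P])+
    qed
  qed
  moreover have "P' x \<in> pos_def_matrices" if "x \<in> K" for x
    unfolding P'_def using that by (intro gmean(1) metric_pos_def[OF P] pullback_pos_def[OF P])
  ultimately show "metric P'"
    by (auto simp: metric_def)
  show "displaced t P' (sqrt c)"
    unfolding displaced_def
  proof
    fix x assume x: "x \<in> K"
    have "pullback t P' x = gmean (pullback t P x) (pullback (t + t) P x)"
      unfolding pullback_def[of t P'] P'_def pullback_add using x
      by (subst gmean_congruence[symmetric])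
        (auto simp: pullback_def[of t P x] metric_pos_def[OF P] pullback_pos_def[OF P] funpow_in invertible_D)
    moreover have "P' x = gmean (pullback t P x) (P x)"
      unfolding P'_def using x by (intro gmean_commute metric_pos_def[OF P] pullback_pos_def[OF P])
    ultimately show "expansion_le (P' x) (pullback t P' x) (sqrt c)"
      using disp x unfolding displaced_def
      by (simp add: expansion_le_gmean metric_pos_def[OF P] pullback_pos_def[OF P])
  qed
qed

lemma displaced_one:
  assumes "metric P" "displaced (2 ^ k) P (c ^ 2 ^ k)" "0 < c"
  shows "\<exists>P'. metric P' \<and> displaced 1 P' c"
  using assms
proof (induction k arbitrary: P)
  case (Suc k)
  have "c ^ 2 ^ Suc k = (c ^ 2 ^ k)\<^sup>2"
    by (simp add: power_mult[symmetric] mult.commute)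
  then have "sqrt (c ^ 2 ^ Suc k) = c ^ 2 ^ k"
    using Suc.prems(3) by simp
  moreover have "displaced (2 ^ k + 2 ^ k) P (c ^ 2 ^ Suc k)"
    using Suc.prems(2) by (simp add: mult_2)
  ultimately obtain P' where "metric P'" "displaced (2 ^ k) P' (c ^ 2 ^ k)"
    using displaced_halve[OF Suc.prems(1)] by metis
  then show ?case
    using Suc.IH Suc.prems(3) by blast
qed auto

lemma ex_metric_Sigma_le:
  assumes K: "K = closure (interior K)" and e: "0 < \<epsilon>"
  shows "\<exists>P. metric P \<and> (\<forall>x\<in>K. Sigma_metric P \<phi> x - ereal \<epsilon> \<le> restoration_entropy \<phi> K)"
proof -
  obtain r H where r: "\<forall>t. local_entropy t = ereal (r t)" and H: "(\<lambda>t. r t / real t) \<longlonglongrightarrow> H"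
    and ent: "restoration_entropy \<phi> K = ereal H"
    using restoration_entropy_limit .
  \<comment> \<open>The first term is the logarithm of the factor \<open>3 ^ CARD('n)\<close> in
    \<open>local_entropy_lower\<close>; the 1 makes its strict hypothesis available.\<close>
  define A where "A = CARD('n) * log 2 3 + 1"
  have "(\<lambda>t. r t / real t + A / real t) \<longlonglongrightarrow> H + 0"
    by (intro tendsto_add H lim_const_over_n)
  then have "\<forall>\<^sub>F t in sequentially. r t / real t + A / real t < H + \<epsilon>"
    using e by (intro order_tendstoD) auto
  then obtain t0 where t0: "\<And>t. t \<ge> t0 \<Longrightarrow> r t / real t + A / real t < H + \<epsilon>"
    unfolding eventually_sequentially by blast
  \<comment> \<open>A power of two, so that repeated halving ends at one step; the exponent
    \<open>t0\<close> already ensures \<open>t \<ge> t0\<close>.\<close>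
  define t :: nat where "t = 2 ^ t0"
  have tpos: "t > 0"
    by (simp add: t_def)
  have "t \<ge> t0"
    unfolding t_def using less_exp[of t0] by simp
  then have rt: "r t + A \<le> real t * (H + \<epsilon>)"
    using t0[of t] tpos by (simp add: field_simps)
  define c where "c = 4 powr (H + \<epsilon>)"
  have cpos: "0 < c"
    by (simp add: c_def)
  have int: "det (gram (D t a)) \<le> c ^ t" if a: "a \<in> interior K" for a
  proof -
    have "local_entropy t < ereal (r t + 1)"
      using r by simp
    then have "sqrt (det (gram (D t a))) \<le> 3 ^ CARD('n) * 2 powr (r t + 1)"
      by (rule local_entropy_lower[OF _ a])
    also have "(3::real) ^ CARD('n) = (2 powr log 2 3) powr real CARD('n)"
      by (simp add: powr_realpow)
    also have "\<dots> = 2 powr (CARD('n) * log 2 3)"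
      by (simp only: powr_powr mult.commute)
    also have "2 powr (CARD('n) * log 2 3) * 2 powr (r t + 1) = 2 powr (r t + A)"
      by (simp add: A_def powr_add[symmetric] add_ac)
    also have "\<dots> \<le> 2 powr (real t * (H + \<epsilon>))"
      using rt by simp
    finally have "(sqrt (det (gram (D t a))))\<^sup>2 \<le> (2 powr (real t * (H + \<epsilon>)))\<^sup>2"
      using det_pos_def[OF pos_def_gram, of "D t a"] by (intro power_mono) auto
    moreover have "(2 powr (real t * (H + \<epsilon>)))\<^sup>2 = c ^ t"
      by (simp add: c_def four_powr[symmetric] powr_realpow[symmetric] powr_powr mult.commute)
    ultimately show ?thesis
      using det_pos_def[OF pos_def_gram, of "D t a"] by simp
  qed
  \<comment> \<open>The bound is a closed condition on the point, so it passes from the interior to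
    its closure, which is \<open>K\<close>.\<close>
  have all: "det (gram (D t a)) \<le> c ^ t" if "a \<in> K" for a
  proof -
    have "closed ((\<lambda>a. det (gram (D t a))) -` {..c ^ t})"
      by (rule continuous_closed_vimage)
        (use continuous_on_det_gram[of UNIV t] in \<open>auto simp: continuous_on_eq_continuous_at\<close>)
    moreover have "interior K \<subseteq> (\<lambda>a. det (gram (D t a))) -` {..c ^ t}"
      using int by auto
    ultimately have "closure (interior K) \<subseteq> (\<lambda>a. det (gram (D t a))) -` {..c ^ t}"
      by (intro closure_minimal)
    then show ?thesis
      using that K by auto
  qed
  have "metric (\<lambda>x. mat 1)"
    by (auto simp: metric_def pos_def_mat_1)
  moreover have "displaced t (\<lambda>x. mat 1) (c ^ t)"
    unfolding displaced_def
  proof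
    fix x assume x: "x \<in> K"
    have "det (gram (transpose (D t x))) \<le> c ^ t * det (mat 1 :: real^'n^'n)"
      using all[OF x] unfolding det_gram_transpose[of "D t x"] by (simp add: gram_def)
    \<comment> \<open>\<open>gram (transpose (D t x))\<close> is the sum of the Euclidean form and
      its pullback, hence a witness dominating both.\<close>
    moreover have "mat 1 \<preceq> gram (transpose (D t x))" "pullback t (\<lambda>x. mat 1) x \<preceq> gram (transpose (D t x))"
      by (auto simp: loewner_le_def pullback_def quad_gram quad_mat_1 quad_transpose_mult simp del: transpose_matrix_vector)
    ultimately show "expansion_le (mat 1) (pullback t (\<lambda>x. mat 1) x) (c ^ t)"
      unfolding expansion_le_def using transpose_gram by blast
  qed
  ultimately obtain P where P: "metric P" "displaced 1 P c"
    using displaced_one[of "\<lambda>x. mat 1" t0 c] cpos by (auto simp: t_def)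
  have "Sigma_metric P \<phi> x - ereal \<epsilon> \<le> ereal H" if x: "x \<in> K" for x
  proof -
    have "Sigma_metric P \<phi> x \<le> ereal (H + \<epsilon>)"
      using P x unfolding Sigma_metric_le[OF P(1) x] by (simp add: displaced_def c_def)
    moreover obtain s where "Sigma_metric P \<phi> x = ereal s"
      using Sigma_metric_real[OF P(1) x] by blast
    ultimately show ?thesis
      by simp
  qed
  then show ?thesis
    using P(1) ent by auto
qed

end

theorem theorem3p2:
  fixes \<phi> :: "real^'n \<Rightarrow> real^'n" and K :: "(real^'n) set"
  assumes "C1_map \<phi>" and "compact K" and "K \<noteq> {}" and "\<phi> ` K \<subseteq> K"
  shows "(\<forall>P. continuous_on K P \<and> P ` K \<subseteq> pos_def_matrices \<longrightarrow>
            (\<exists>x\<in>K. (\<forall>y\<in>K. Sigma_metric P \<phi> y \<le> Sigma_metric P \<phi> x) \<and>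
                   restoration_entropy \<phi> K \<le> Sigma_metric P \<phi> x)) \<and>
         (K = closure (interior K) \<and> (\<forall>x\<in>K. invertible (jacobian \<phi> (at x))) \<longrightarrow>
            (\<forall>\<epsilon>::real. \<epsilon> > 0 \<longrightarrow>
              (\<exists>P. continuous_on K P \<and> P ` K \<subseteq> pos_def_matrices \<and>
                 (\<exists>x\<in>K. (\<forall>y\<in>K. Sigma_metric P \<phi> y \<le> Sigma_metric P \<phi> x) \<and>
                        restoration_entropy \<phi> K \<ge> Sigma_metric P \<phi> x - ereal \<epsilon>))))"
proof -
  interpret compact_invariant \<phi> K
    using assms by unfold_locales
  have upper: "\<exists>x\<in>K. (\<forall>y\<in>K. Sigma_metric P \<phi> y \<le> Sigma_metric P \<phi> x) \<and>
      restoration_entropy \<phi> K \<le> Sigma_metric P \<phi> x" if P: "metric P" for P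
  proof -
    obtain x where x: "x \<in> K" "\<And>y. y \<in> K \<Longrightarrow> Sigma_metric P \<phi> y \<le> Sigma_metric P \<phi> x"
      using Sigma_metric_attains_max[OF P] by blast
    obtain s where s: "Sigma_metric P \<phi> x = ereal s"
      using Sigma_metric_real[OF P x(1)] by blast
    then have "restoration_entropy \<phi> K \<le> ereal s"
      using x(2) by (intro restoration_entropy_le[OF P]) simp
    then show ?thesis
      using x s by (intro bexI[of _ x]) auto
  qed
  have lower: "\<exists>P. metric P \<and> (\<exists>x\<in>K. (\<forall>y\<in>K. Sigma_metric P \<phi> y \<le> Sigma_metric P \<phi> x) \<and>
      restoration_entropy \<phi> K \<ge> Sigma_metric P \<phi> x - ereal \<epsilon>)"
    if K: "K = closure (interior K)" and inv: "\<forall>x\<in>K. invertible (jacobian \<phi> (at x))"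
      and e: "\<epsilon> > 0" for \<epsilon>
  proof -
    interpret compact_invariant_immersion \<phi> K
      using inv by unfold_locales auto
    obtain P where P: "metric P" "\<forall>x\<in>K. Sigma_metric P \<phi> x - ereal \<epsilon> \<le> restoration_entropy \<phi> K"
      using ex_metric_Sigma_le[OF K e] by blast
    then show ?thesis
      using Sigma_metric_attains_max[OF P(1)] by blast
  qed
  show ?thesis
    using upper lower unfolding metric_def by blast
qed

end
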